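(* Let $U$, $a_0,\dots,a_N$, $a\in(0,1)$, $K(x,\xi)$ and $W_1(x)$ be as described in the context, and let $\varphi$ be any positive function on $U$. Assume there are $r>2$ and $c_0>0$ such that $$\|u\|_{L^r_\varphi(U)}\le c_0\|\nabla u\|_{L^{2-a}_{W_1}(U)}$$ for any $u(x)$ belonging to a space $\mathring X^{r,2-a}_{\varphi,W_1}(U)$ of functions on $U$ vanishing on $\Gamma$. Let $r'=r/(r-1)$. Then for any $T>0$, any $u(x,t)\in\mathring X^{r,2-a}_{\varphi,W_1}(Q_T)$ and any function $f(x,t)\ge0$ on $Q_T$, one has $$\|u\|_{L^{4/r'}_\varphi(Q_T)}\le c_0^{\frac{r'}2}\Big(\int_Ua_N(x)dx+\operatorname*{ess\,sup}_{0<t<T}\int_UW_1(x)f(x,t)^{2-a}\chi_{\operatorname{supp}u}(x,t)dx\Big)^{\frac{ar'}{4(2-a)}}$$ $$\qquad\cdot\Big\{\operatorname*{ess\,sup}_{0<t<T}\|u(t)\|_{L^2_\varphi(U)}+\Big(\int_0^T\!\!\int_UK(x,f(x,t))|\nabla u(x,t)|^2dx\,dt\Big)^{\frac12}\Big\}.$$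
   Context: $U\subset\mathbb R^n$ ($n\ge2$) is a bounded domain with $C^1$ boundary $\Gamma$. Let $N\ge1$, $0=\alpha_0<\alpha_1<\dots<\alpha_N$ be fixed real numbers, and let $a_0,\dots,a_N$ be functions on $\bar U$ with $a_0,a_N>0$ and $a_1,\dots,a_{N-1}\ge0$. Put $g(x,s)=\sum_{j=0}^N a_j(x)s^{\alpha_j}$ for $s\ge0$, and $a=\frac{\alpha_N}{\alpha_N+1}\in(0,1)$. For $\xi\ge0$ let $s(x,\xi)$ be the unique nonnegative solution $s$ of $s\,g(x,s)=\xi$, and $K(x,\xi)=1/g(x,s(x,\xi))$. Let $M(x)=\max_{0\le j\le N}a_j(x)$ and $W_1(x)=\frac{a_N(x)^a}{2NM(x)}$. $Q_T=U\times(0,T)$, $u(t)=u(\cdot,t)$, $\nabla$ is the spatial gradient, $\chi_{\operatorname{supp}u}$ is the characteristic function of the support of $u$. $\mathring X^{r,2-a}_{\varphi,W_1}(Q_T)$ denotes the set of functions $u(x,t)$ such that $u(\cdot,t)\in\mathring X^{r,2-a}_{\varphi,W_1}(U)$ for almost all $t\in(0,T)$. For a weight $w\ge0$ on $U$, $L^s_w(U)$ and $L^s_w(Q_T)$ are the $L^s$ spaces with respect to the measures $w(x)\,dx$ and $w(x)\,dx\,dt$, respectively. *)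

theory Defs
  imports "HOL-Analysis.Analysis" "HOL-Probability.Essential_Supremum"
begin

section \<open>Bounded domains with continuously differentiable boundary\<close>

text \<open>
  Near each boundary point the set is, in the direction of a suitable unit vector \<open>e\<close>, the
  strict epigraph of a \<open>C\<^sup>1\<close> function of the component orthogonal to \<open>e\<close>.  That function is
  given on the whole space but only its values on the hyperplane orthogonal to \<open>e\<close> matter.
\<close>

definition C1_boundary :: "'a::euclidean_space set \<Rightarrow> bool" where
  "C1_boundary U \<longleftrightarrow>
     (\<forall>y \<in> frontier U. \<exists>e \<rho> \<gamma> D\<gamma>. norm e = 1 \<and> \<rho> > (0::real) \<and>
        (\<forall>z. GDERIV \<gamma> z :> D\<gamma> z) \<and> continuous_on UNIV D\<gamma> \<and>
        U \<inter> ball y \<rho> = {x \<in> ball y \<rho>. \<gamma> (x - (x \<bullet> e) *\<^sub>R e) < x \<bullet> e})"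

definition bounded_C1_domain :: "'a::euclidean_space set \<Rightarrow> bool" where
  "bounded_C1_domain U \<longleftrightarrow>
     open U \<and> connected U \<and> U \<noteq> {} \<and> bounded U \<and> C1_boundary U"

section \<open>Weighted Lebesgue norms\<close>

text \<open>Powers with a positive exponent \<open>p\<close> of extended nonnegative reals.\<close>

definition ennpowr :: "ennreal \<Rightarrow> real \<Rightarrow> ennreal" where
  "ennpowr x p = (if x = top then top else ennreal (enn2real x powr p))"

definition wLp_norm ::
  "real \<Rightarrow> 'a::euclidean_space set \<Rightarrow> ('a \<Rightarrow> real) \<Rightarrow> ('a \<Rightarrow> 'b::real_normed_vector) \<Rightarrow> ennreal" where
  "wLp_norm p S w v =
     ennpowr (\<integral>\<^sup>+x. ennreal (norm (v x) powr p) \<partial>density (lebesgue_on S) (\<lambda>x. ennreal (w x)))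
       (1 / p)"

section \<open>Weak gradients\<close>

text \<open>
  Test functions are compactly supported \<open>C\<^sup>1\<close> functions, as in Gilbarg and Trudinger; by
  mollification smooth test functions define the same weak gradients.
\<close>

definition test_function ::
  "'a::euclidean_space set \<Rightarrow> ('a \<Rightarrow> real) \<Rightarrow> ('a \<Rightarrow> 'a) \<Rightarrow> bool" where
  "test_function U \<psi> D\<psi> \<longleftrightarrow>
     (\<forall>x. GDERIV \<psi> x :> D\<psi> x) \<and> continuous_on UNIV D\<psi> \<and>
     (\<exists>C. compact C \<and> C \<subseteq> U \<and> (\<forall>x. x \<notin> C \<longrightarrow> \<psi> x = 0))"

definition has_weak_gradient ::
  "'a::euclidean_space set \<Rightarrow> ('a \<Rightarrow> real) \<Rightarrow> ('a \<Rightarrow> 'a) \<Rightarrow> bool" where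
  "has_weak_gradient U v G \<longleftrightarrow>
     (\<forall>C. compact C \<and> C \<subseteq> U \<longrightarrow> v absolutely_integrable_on C \<and> G absolutely_integrable_on C) \<and>
     (\<forall>\<psi> D\<psi>. test_function U \<psi> D\<psi> \<longrightarrow>
        (\<integral>x. v x *\<^sub>R D\<psi> x \<partial>lebesgue_on U) = - (\<integral>x. \<psi> x *\<^sub>R G x \<partial>lebesgue_on U))"

text \<open>The weak gradient is unique up to null sets; \<open>weak_grad\<close> selects a representative.\<close>

definition weak_grad :: "'a::euclidean_space set \<Rightarrow> ('a \<Rightarrow> real) \<Rightarrow> 'a \<Rightarrow> 'a" where
  "weak_grad U v = (SOME G. has_weak_gradient U v G)"

section \<open>Functions vanishing on the boundary\<close>

text \<open>
  Null sets of the Hausdorff measure of dimension \<open>n - 1\<close>, that is, of the surface measure on a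
  hypersurface.
\<close>

definition surface_null :: "'a::euclidean_space set \<Rightarrow> bool" where
  "surface_null Z \<longleftrightarrow>
     (\<forall>\<epsilon>>0. \<exists>(c :: nat \<Rightarrow> 'a) (\<rho> :: nat \<Rightarrow> real). (\<forall>i. \<rho> i > 0) \<and>
        Z \<subseteq> (\<Union>i. ball (c i) (\<rho> i)) \<and>
        (\<Sum>i. ennreal (\<rho> i ^ (DIM('a) - 1))) < ennreal \<epsilon>)"

text \<open>
  Zero trace: at almost every boundary point the averages of \<open>\<bar>v\<bar>\<close> over small balls, intersected
  with the domain, tend to zero.  On a bounded \<open>C\<^sup>1\<close> domain this is the usual zero trace for
  functions in \<open>W\<^sup>1\<^sup>,\<^sup>1\<close>, and it holds for functions that are continuous up to the boundary
  and zero there.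
\<close>

definition vanishes_on_boundary :: "'a::euclidean_space set \<Rightarrow> ('a \<Rightarrow> real) \<Rightarrow> bool" where
  "vanishes_on_boundary U v \<longleftrightarrow>
     (\<exists>Z. surface_null Z \<and>
        (\<forall>y \<in> frontier U - Z.
           ((\<lambda>\<rho>. (\<integral>\<^sup>+x. ennreal \<bar>v x\<bar> \<partial>lebesgue_on (U \<inter> ball y \<rho>)) / emeasure lborel (ball y \<rho>))
              \<longlongrightarrow> 0) (at_right 0)))"

section \<open>The function spaces\<close>

definition wX :: "'a::euclidean_space set \<Rightarrow> ('a \<Rightarrow> real) \<Rightarrow> ('a \<Rightarrow> real) \<Rightarrow> real \<Rightarrow> real
    \<Rightarrow> ('a \<Rightarrow> real) set" where
  "wX U \<phi> W r p =
     {v. v \<in> borel_measurable (lebesgue_on U) \<and> wLp_norm r U \<phi> v < top \<and>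
         (\<exists>G. has_weak_gradient U v G) \<and> wLp_norm p U W (weak_grad U v) < top}"

text \<open>
  \<open>is_wX0 U \<phi> W r p X\<close>: \<open>X\<close> is a linear space of functions from \<open>wX U \<phi> W r p\<close> that vanish on
  the boundary.  It need not contain all such functions.
\<close>

definition is_wX0 :: "'a::euclidean_space set \<Rightarrow> ('a \<Rightarrow> real) \<Rightarrow> ('a \<Rightarrow> real) \<Rightarrow> real \<Rightarrow> real
    \<Rightarrow> ('a \<Rightarrow> real) set \<Rightarrow> bool" where
  "is_wX0 U \<phi> W r p X \<longleftrightarrow>
     X \<subseteq> wX U \<phi> W r p \<and> (\<forall>v \<in> X. vanishes_on_boundary U v) \<and>
     (\<lambda>x. 0) \<in> X \<and> (\<forall>v \<in> X. \<forall>w \<in> X. (\<lambda>x. v x + w x) \<in> X) \<and>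
     (\<forall>c. \<forall>v \<in> X. (\<lambda>x. c * v x) \<in> X)"

definition X_QT :: "('a \<Rightarrow> real) set \<Rightarrow> real \<Rightarrow> ('a \<Rightarrow> real \<Rightarrow> real) set" where
  "X_QT X T = {u. AE t in lebesgue_on {0<..<T}. (\<lambda>x. u x t) \<in> X}"

abbreviation Q_T :: "'a set \<Rightarrow> real \<Rightarrow> ('a \<times> real) set" where
  "Q_T U T \<equiv> U \<times> {0<..<T}"

definition supp_QT :: "'a::euclidean_space set \<Rightarrow> real \<Rightarrow> ('a \<Rightarrow> real \<Rightarrow> real) \<Rightarrow> ('a \<times> real) set" where
  "supp_QT U T u = closure {(x, t) \<in> Q_T U T. u x t \<noteq> 0} \<inter> Q_T U T"

section \<open>The generalized Forchheimer polynomial and its weights\<close>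

text \<open>Real powers with \<open>0\<^sup>0 = 1\<close>; note that \<open>0 powr 0 = 0\<close>.\<close>

definition rpow :: "real \<Rightarrow> real \<Rightarrow> real" where
  "rpow s p = (if p = 0 then 1 else s powr p)"

definition forch_g :: "nat \<Rightarrow> (nat \<Rightarrow> real) \<Rightarrow> (nat \<Rightarrow> 'a \<Rightarrow> real) \<Rightarrow> 'a \<Rightarrow> real \<Rightarrow> real" where
  "forch_g N \<alpha> a x s = (\<Sum>j\<le>N. a j x * rpow s (\<alpha> j))"

definition forch_s :: "nat \<Rightarrow> (nat \<Rightarrow> real) \<Rightarrow> (nat \<Rightarrow> 'a \<Rightarrow> real) \<Rightarrow> 'a \<Rightarrow> real \<Rightarrow> real" where
  "forch_s N \<alpha> a x \<xi> = (THE s. s \<ge> 0 \<and> s * forch_g N \<alpha> a x s = \<xi>)"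

definition forch_K :: "nat \<Rightarrow> (nat \<Rightarrow> real) \<Rightarrow> (nat \<Rightarrow> 'a \<Rightarrow> real) \<Rightarrow> 'a \<Rightarrow> real \<Rightarrow> real" where
  "forch_K N \<alpha> a x \<xi> = 1 / forch_g N \<alpha> a x (forch_s N \<alpha> a x \<xi>)"

definition forch_exp :: "nat \<Rightarrow> (nat \<Rightarrow> real) \<Rightarrow> real" where
  "forch_exp N \<alpha> = \<alpha> N / (\<alpha> N + 1)"

definition forch_M :: "nat \<Rightarrow> (nat \<Rightarrow> 'a \<Rightarrow> real) \<Rightarrow> 'a \<Rightarrow> real" where
  "forch_M N a x = Max ((\<lambda>j. a j x) ` {..N})"

definition forch_W1 :: "nat \<Rightarrow> (nat \<Rightarrow> real) \<Rightarrow> (nat \<Rightarrow> 'a \<Rightarrow> real) \<Rightarrow> 'a \<Rightarrow> real" where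
  "forch_W1 N \<alpha> a x = a N x powr forch_exp N \<alpha> / (2 * real N * forch_M N a x)"

end

theory Submission
  imports Defs
begin

text \<open>
  Write \<open>p = 2 - b\<close>, where \<open>b = \<alpha>\<^sub>N / (\<alpha>\<^sub>N + 1)\<close>, and \<open>q = 4/r' = 4 - 4/r\<close>.
  The inequality is an interpolation in space followed by an integration in time.

  On a single time slice, Hoelder's inequality gives
  \<open>\<integral> \<phi> |u|\<^bsup>q\<^esup> \<le> \<parallel>u\<parallel>\<^bsub>2,\<phi>\<^esub>\<^bsup>2 - 4/r\<^esup> \<parallel>u\<parallel>\<^bsub>r,\<phi>\<^esub>\<^sup>2\<close> (lemma \<open>wLp_interpolation\<close>), and the assumed Sobolev inequality
  replaces the last norm by \<open>c\<^sub>0 \<parallel>\<nabla>u\<parallel>\<close> in \<open>L\<^sup>p\<close> with weight \<open>W\<^sub>1\<close>.  This weighted norm is controlled by the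
  energy with the degenerate conductivity \<open>K\<close> (lemma \<open>weighted_norm_le_energy\<close>):
  the bound \<open>K(x,\<xi>) \<ge> 2 W\<^sub>1 / (\<xi>\<^bsup>b\<^esup> + a\<^sub>N\<^bsup>b\<^esup>)\<close> (lemma \<open>forch_K_lower_bound\<close>) and another application of
  Hoelder's inequality, with exponents \<open>p/2\<close> and \<open>b/2\<close>, give
  \<open>\<parallel>\<nabla>u\<parallel>\<^sup>2 \<le> (\<integral> K |\<nabla>u|\<^sup>2) (\<integral> a\<^sub>N + \<integral> W\<^sub>1 f\<^bsup>p\<^esup> \<chi>)\<^bsup>b/p\<^esup>\<close>.  The characteristic function \<open>\<chi>\<close> of the support may be
  inserted because the weak gradient vanishes almost everywhere on the open complement of the
  support (lemma \<open>weak_gradient_zero_where_function_zero\<close>).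

  Altogether \<open>\<integral> \<phi> |u(t)|\<^bsup>q\<^esup> \<le> C \<integral> K |\<nabla>u(t)|\<^sup>2\<close> for almost every \<open>t\<close>, with a constant \<open>C\<close> formed from
  \<open>c\<^sub>0\<close>, \<open>\<integral> a\<^sub>N\<close> and essential suprema in time.  Integrating over \<open>t\<close> and taking the \<open>q\<close>-th root
  leaves, besides the first two factors of the bound, the product of powers of the supremum \<open>S\<close> of
  the \<open>L\<^sup>2\<close> norms and of the energy norm \<open>J\<close>, with exponents adding up to \<open>1\<close>; such a product is at
  most \<open>S + J\<close>.

  The integrals take values in \<open>[0,\<infinity>]\<close>, so infinite and vanishing factors are part of the
  estimates.  Measurability requires some care, since the functions on the cylinder are measurable
  only with respect to the completed product measure (lemma \<open>nn_integral_lebesgue_on_Times\<close>).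
\<close>

section \<open>Powers in the extended nonnegative reals and integral inequalities\<close>

lemma ennpowr_ennreal: "0 \<le> x \<Longrightarrow> ennpowr (ennreal x) p = ennreal (x powr p)"
  by (simp add: ennpowr_def)

lemma ennpowr_top [simp]: "ennpowr top p = top"
  by (simp add: ennpowr_def)

lemma ennpowr_zero [simp]: "ennpowr 0 p = 0"
  by (simp add: ennpowr_def)

lemma ennpowr_one [simp]: "ennpowr x 1 = x"
  by (cases x) (auto simp: ennpowr_def)

lemma ennpowr_eq_0_iff [simp]: "ennpowr x p = 0 \<longleftrightarrow> x = 0"
  by (cases x) (auto simp: ennpowr_def ennreal_eq_0_iff)

lemma ennpowr_eq_top_iff [simp]: "ennpowr x p = top \<longleftrightarrow> x = top"
  by (cases x) (auto simp: ennpowr_def)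

lemma ennpowr_mono: "x \<le> y \<Longrightarrow> 0 \<le> p \<Longrightarrow> ennpowr x p \<le> ennpowr y p"
  by (cases x; cases y) (auto simp: ennpowr_ennreal ennreal_le_iff powr_mono2 top_unique)

lemma ennpowr_ennpowr: "ennpowr (ennpowr x p) q = ennpowr x (p * q)"
  by (cases x) (auto simp: ennpowr_ennreal powr_powr)

lemma ennpowr_mult: "ennpowr (x * y) p = ennpowr x p * ennpowr y p"
  by (cases x; cases y)
     (auto simp: ennpowr_ennreal ennreal_mult[symmetric] powr_mult ennreal_mult_top ennreal_top_mult)

lemma ennpowr_add_exponents: "ennpowr x (p + q) = ennpowr x p * ennpowr x q"
  by (cases x) (auto simp: ennpowr_ennreal ennreal_mult[symmetric] powr_add)

lemma ennpowr_mult_le_add: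
  assumes "0 \<le> \<theta>" "0 \<le> \<eta>" "\<theta> + \<eta> = 1"
  shows "ennpowr x \<theta> * ennpowr y \<eta> \<le> x + y"
proof -
  have "ennpowr x \<theta> * ennpowr y \<eta> \<le> ennpowr (x + y) \<theta> * ennpowr (x + y) \<eta>"
    using assms by (intro mult_mono ennpowr_mono) auto
  also have "\<dots> = x + y"
    using assms(3) by (simp add: ennpowr_add_exponents[symmetric])
  finally show ?thesis .
qed

text \<open>
  The exponents are placed on the integrands, and the integrals may be \<open>0\<close> or \<open>\<infinity>\<close>.  If both are
  finite and positive, normalising them to \<open>1\<close> reduces the claim to Young's inequality at each
  point.  If one of them is \<open>0\<close>, the product vanishes almost everywhere, which matches the
  convention \<open>0 * \<infinity> = 0\<close> on the right.
\<close>

lemma nn_integral_Holder: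
  fixes F G :: "'a \<Rightarrow> real"
  assumes [measurable]: "F \<in> borel_measurable M" "G \<in> borel_measurable M"
    and F: "\<And>x. x \<in> space M \<Longrightarrow> 0 \<le> F x" and G: "\<And>x. x \<in> space M \<Longrightarrow> 0 \<le> G x"
    and \<theta>: "0 < \<theta>" "0 < \<eta>" "\<theta> + \<eta> = 1"
  shows "(\<integral>\<^sup>+x. ennreal (F x powr \<theta> * G x powr \<eta>) \<partial>M)
    \<le> ennpowr (\<integral>\<^sup>+x. ennreal (F x) \<partial>M) \<theta> * ennpowr (\<integral>\<^sup>+x. ennreal (G x) \<partial>M) \<eta>"
proof -
  let ?I = "\<integral>\<^sup>+x. ennreal (F x) \<partial>M" and ?J = "\<integral>\<^sup>+x. ennreal (G x) \<partial>M"
  consider "?I = 0 \<or> ?J = 0" | "?I \<noteq> 0" "?J \<noteq> 0" "?I = top \<or> ?J = top" 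
    | "?I \<noteq> 0" "?J \<noteq> 0" "?I < top" "?J < top"
    unfolding less_top[symmetric] by blast
  then show ?thesis
  proof cases
    case 1
    then have "(AE x in M. F x = 0) \<or> (AE x in M. G x = 0)"
      using F G by (simp add: nn_integral_0_iff_AE ennreal_eq_0_iff) 
        (metis (mono_tags, lifting) AE_mp AE_space AE_I2 antisym)
    then have "AE x in M. ennreal (F x powr \<theta> * G x powr \<eta>) = 0"
      by auto
    then have "(\<integral>\<^sup>+x. ennreal (F x powr \<theta> * G x powr \<eta>) \<partial>M) = 0"
      by (subst nn_integral_0_iff_AE) auto
    then show ?thesis by simp
  next
    case 2
    then show ?thesis
      by (auto simp: ennreal_mult_top ennreal_top_mult)
  next
    case 3
    obtain i j where i: "?I = ennreal i" "0 < i" and j: "?J = ennreal j" "0 < j"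
      using 3 by (cases ?I; cases ?J) (auto simp: less_le)
    have "F x powr \<theta> * G x powr \<eta> \<le> i powr \<theta> * j powr \<eta> * (\<theta> * (F x / i) + \<eta> * (G x / j))"
      if x: "x \<in> space M" for x
    proof (cases "F x = 0 \<or> G x = 0")
      case True
      then show ?thesis using F[OF x] G[OF x] i j \<theta> by auto
    next
      case False
      then have "F x > 0" "G x > 0" using F[OF x] G[OF x] by auto
      then have "(F x / i) powr \<theta> * (G x / j) powr \<eta> \<le> \<theta> * (F x / i) + \<eta> * (G x / j)"
        using i j \<theta> by (intro Youngs_inequality_0) auto
      then have "i powr \<theta> * j powr \<eta> * ((F x / i) powr \<theta> * (G x / j) powr \<eta>) 
          \<le> i powr \<theta> * j powr \<eta> * (\<theta> * (F x / i) + \<eta> * (G x / j))"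
        using i j by (intro mult_left_mono) auto
      also have "i powr \<theta> * j powr \<eta> * ((F x / i) powr \<theta> * (G x / j) powr \<eta>) 
          = F x powr \<theta> * G x powr \<eta>"
        using i j \<open>F x > 0\<close> \<open>G x > 0\<close> by (simp add: powr_divide)
      finally show ?thesis .
    qed
    then have "(\<integral>\<^sup>+x. ennreal (F x powr \<theta> * G x powr \<eta>) \<partial>M) 
        \<le> (\<integral>\<^sup>+x. ennreal (i powr \<theta> * j powr \<eta> * \<theta> / i) * ennreal (F x) 
            + ennreal (i powr \<theta> * j powr \<eta> * \<eta> / j) * ennreal (G x) \<partial>M)"
      using F G i j \<theta> 
      by (intro nn_integral_mono) (simp add: ennreal_mult[symmetric] ennreal_plus[symmetric] 
           algebra_simps del: ennreal_plus)
    also have "\<dots> = ennreal (i powr \<theta> * j powr \<eta> * \<theta> / i) * ?I 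
        + ennreal (i powr \<theta> * j powr \<eta> * \<eta> / j) * ?J"
      by (simp add: nn_integral_add nn_integral_cmult)
    also have "\<dots> = ennreal (i powr \<theta> * j powr \<eta> * (\<theta> + \<eta>))"
      using i j \<theta>(1,2)
      by (simp add: ennreal_mult[symmetric] ennreal_plus[symmetric] algebra_simps del: ennreal_plus)
    finally show ?thesis
      using i j \<theta>(3) by (simp add: ennpowr_ennreal ennreal_mult)
  qed
qed

text \<open>
  The function \<open>B\<close> need not be measurable: dividing by the constant moves it to the measurable
  function \<open>A\<close>, and the integral is monotone on arbitrary functions.  This is applied to
  \<open>B t = \<integral>\<^sup>+x. K(x, f(x,t)) |\<nabla>u(x,t)|\<^sup>2\<close>, where \<open>\<nabla>u(\<cdot>,t)\<close> is selected separately for every \<open>t\<close>, so that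
  joint measurability in \<open>(x,t)\<close> is unclear.
\<close>

lemma nn_integral_le_cmult:
  fixes A B :: "'a \<Rightarrow> ennreal"
  assumes A: "A \<in> borel_measurable M" and le: "AE x in M. A x \<le> C * B x" and C: "C \<noteq> top"
  shows "(\<integral>\<^sup>+x. A x \<partial>M) \<le> C * (\<integral>\<^sup>+x. B x \<partial>M)"
proof (cases "C = 0")
  case True
  then have "(\<integral>\<^sup>+x. A x \<partial>M) = (\<integral>\<^sup>+x. 0 \<partial>M)"
    using le by (intro nn_integral_cong_AE) auto
  then show ?thesis by simp
next
  case False
  have cancel: "C * (y / C) = y" for y
    using C False by (metis ennreal_mult_divide_eq ennreal_times_divide mult.commute)
  have "AE x in M. A x / C \<le> B x"
    using le
  proof eventually_elim
    case (elim x)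
    have "A x / C \<le> C * B x / C" using elim by (rule divide_right_mono_ennreal)
    also have "\<dots> = B x" using C False by (metis ennreal_mult_divide_eq mult.commute)
    finally show ?case .
  qed
  then have "(\<integral>\<^sup>+x. A x / C \<partial>M) \<le> (\<integral>\<^sup>+x. B x \<partial>M)"
    by (rule nn_integral_mono_AE)
  then have "C * (\<integral>\<^sup>+x. A x / C \<partial>M) \<le> C * (\<integral>\<^sup>+x. B x \<partial>M)"
    by (rule mult_left_mono) simp
  also have "C * (\<integral>\<^sup>+x. A x / C \<partial>M) = (\<integral>\<^sup>+x. C * (A x / C) \<partial>M)"
    using A by (intro nn_integral_cmult[symmetric]) (rule borel_measurable_divide_ennreal, simp_all)
  finally show ?thesis by (simp add: cancel)
qed

lemma wLp_norm_eq:
  assumes w [measurable]: "w \<in> borel_measurable (lebesgue_on S)" and w0: "\<And>x. x \<in> S \<Longrightarrow> 0 \<le> w x"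
    and v [measurable]: "v \<in> borel_measurable (lebesgue_on S)"
  shows "wLp_norm p S w v 
    = ennpowr (\<integral>\<^sup>+x. ennreal (w x * norm (v x) powr p) \<partial>lebesgue_on S) (1 / p)"
proof -
  have "(\<integral>\<^sup>+x. ennreal (norm (v x) powr p) \<partial>density (lebesgue_on S) (\<lambda>x. ennreal (w x)))
      = (\<integral>\<^sup>+x. ennreal (w x) * ennreal (norm (v x) powr p) \<partial>lebesgue_on S)"
    by (intro nn_integral_density) measurable
  also have "\<dots> = (\<integral>\<^sup>+x. ennreal (w x * norm (v x) powr p) \<partial>lebesgue_on S)"
    using w0 by (intro nn_integral_cong) (simp add: ennreal_mult)
  finally show ?thesis by (simp add: wLp_norm_def)
qed

text \<open>
  The factorisation \<open>|v|\<^bsup>4 - 4/r\<^esup> = (|v|\<^sup>2)\<^bsup>1 - 2/r\<^esup> (|v|\<^bsup>r\<^esup>)\<^bsup>2/r\<^esup>\<close>.  The exponent \<open>4 - 4/r\<close> is singled out because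
  the \<open>L\<^sup>r\<close> norm then enters with the power \<open>2\<close>, so that a bound of this norm by the square root of an
  energy can be integrated in time.
\<close>

lemma wLp_interpolation:
  fixes v :: "'a::euclidean_space \<Rightarrow> real"
  assumes [measurable]: "w \<in> borel_measurable (lebesgue_on S)" "v \<in> borel_measurable (lebesgue_on S)"
    and w0: "\<And>x. x \<in> S \<Longrightarrow> 0 \<le> w x" and r: "2 < r"
  shows "(\<integral>\<^sup>+x. ennreal (w x * norm (v x) powr (4 - 4 / r)) \<partial>lebesgue_on S)
    \<le> ennpowr (wLp_norm 2 S w v) (2 - 4 / r) * ennpowr (wLp_norm r S w v) 2"
proof -
  have "w x * norm (v x) powr (4 - 4 / r) 
      = (w x * norm (v x) powr 2) powr (1 - 2 / r) * (w x * norm (v x) powr r) powr (2 / r)"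
    if "x \<in> S" for x
  proof -
    have "(w x * norm (v x) powr 2) powr (1 - 2 / r) * (w x * norm (v x) powr r) powr (2 / r)
        = (w x powr (1 - 2 / r) * w x powr (2 / r)) 
          * (norm (v x) powr (2 * (1 - 2 / r)) * norm (v x) powr (r * (2 / r)))"
      using w0[OF that] by (simp add: powr_mult powr_powr mult_ac del: powr_numeral)
    also have "\<dots> = w x powr 1 * norm (v x) powr (2 * (1 - 2 / r) + r * (2 / r))"
      by (simp only: powr_add[symmetric]) simp
    also have "2 * (1 - 2 / r) + r * (2 / r) = 4 - 4 / r"
      using r by (simp add: field_simps)
    finally show ?thesis using w0[OF that] by simp
  qed
  then have "(\<integral>\<^sup>+x. ennreal (w x * norm (v x) powr (4 - 4 / r)) \<partial>lebesgue_on S)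
      = (\<integral>\<^sup>+x. ennreal ((w x * norm (v x) powr 2) powr (1 - 2 / r) 
          * (w x * norm (v x) powr r) powr (2 / r)) \<partial>lebesgue_on S)"
    by (intro nn_integral_cong) simp
  also have "\<dots> \<le> ennpowr (\<integral>\<^sup>+x. ennreal (w x * norm (v x) powr 2) \<partial>lebesgue_on S) (1 - 2 / r)
      * ennpowr (\<integral>\<^sup>+x. ennreal (w x * norm (v x) powr r) \<partial>lebesgue_on S) (2 / r)"
    using w0 r by (intro nn_integral_Holder) (auto simp: field_simps simp del: powr_numeral)
  also have "\<dots> = ennpowr (wLp_norm 2 S w v) (2 - 4 / r) * ennpowr (wLp_norm r S w v) 2"
    using r w0 by (simp add: wLp_norm_eq ennpowr_ennpowr diff_divide_distrib)
  finally show ?thesis .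
qed

section \<open>Lebesgue measurable functions on product sets\<close>

lemma borel_measurable_completion_AE_eq:
  fixes f g :: "'a \<Rightarrow> 'b::topological_space"
  assumes g: "g \<in> borel_measurable (completion M)" and eq: "AE x in M. f x = g x"
  shows "f \<in> borel_measurable (completion M)"
proof (rule measurableI)
  fix B :: "'b set" assume B: "B \<in> sets borel"
  have "AE x in completion M. f x = g x"
    using eq by (rule AE_completion)
  then have "AE x in completion M. 
      (x \<in> g -` B \<inter> space (completion M)) = (x \<in> f -` B \<inter> space (completion M))"
    by eventually_elim simp
  moreover have "g -` B \<inter> space (completion M) \<in> sets (completion M)"
    using g B by (rule measurable_sets)
  ultimately show "f -` B \<inter> space (completion M) \<in> sets (completion M)"
    by (rule completion.in_sets_AE) simp
qed simp

text \<open>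
  Fubini's theorem for null sets; the exceptional set is enlarged to a Borel null set, for which the
  two orders of quantification may be exchanged.
\<close>

lemma AE_lborel_sections:
  fixes P :: "'a::euclidean_space \<times> 'b::euclidean_space \<Rightarrow> bool"
  assumes "AE z in lborel. P z"
  shows "AE t in lborel. AE x in lborel. P (x, t)"
proof -
  obtain N where N: "N \<in> null_sets (lborel :: ('a \<times> 'b) measure)" "{z. \<not> P z} \<subseteq> N"
    using assms unfolding eventually_ae_filter by auto
  have [measurable]: "N \<in> sets (lborel \<Otimes>\<^sub>M lborel)"
    using N(1) unfolding lborel_prod by auto
  have "AE z in lborel \<Otimes>\<^sub>M lborel. z \<notin> N"
    using AE_not_in[OF N(1)] by (simp only: lborel_prod)
  then have "AE x in lborel. AE t in lborel. (x, t) \<notin> N"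
    by (rule lborel_pair.AE_pair)
  then have "AE t in lborel. AE x in lborel. (x, t) \<notin> N"
  proof (subst lborel_pair.AE_commute[symmetric])
    have "{z \<in> space (lborel \<Otimes>\<^sub>M lborel). (fst z, snd z) \<notin> N} = space (lborel \<Otimes>\<^sub>M lborel) - N"
      by auto
    also have "\<dots> \<in> sets (lborel \<Otimes>\<^sub>M lborel)"
      by (rule sets.compl_sets) fact
    finally show "{z \<in> space (lborel \<Otimes>\<^sub>M lborel). (fst z, snd z) \<notin> N} \<in> sets (lborel \<Otimes>\<^sub>M lborel)" .
  qed
  then show ?thesis
  proof eventually_elim
    case (elim t)
    then show ?case by eventually_elim (use N(2) in auto)
  qed
qed

lemma AE_lebesgue_on:
  "S \<in> sets lebesgue \<Longrightarrow> (AE x in lebesgue_on S. P x) \<longleftrightarrow> (AE x in lborel. x \<in> S \<longrightarrow> P x)"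
  by (simp add: AE_restrict_space_iff AE_completion_iff)

text \<open>
  Lebesgue measure on a product is the completion of the product of Borel measures, not the product
  of the completions.  Sections and iterated integrals of a Lebesgue measurable function are therefore
  taken through a Borel function that agrees with it almost everywhere; on almost every section the
  two functions still agree almost everywhere.
\<close>

lemma lebesgue_on_Times_Borel_representative:
  fixes F :: "'a::euclidean_space \<times> 'b::euclidean_space \<Rightarrow> real"
  assumes F: "F \<in> borel_measurable (lebesgue_on (A \<times> B))"
    and A: "A \<in> sets borel" and B: "B \<in> sets borel"
  obtains F' where "F' \<in> borel_measurable borel"
    "AE z in lborel. indicator (A \<times> B) z * F z = F' z"
    "AE t in lborel. AE x in lborel. indicator (A \<times> B) (x, t) * F (x, t) = F' (x, t)"
proof -
  have "A \<times> B \<in> sets lebesgue"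
    using A B by (intro sets_completionI_sets) (simp add: borel_Times)
  then have "(\<lambda>z. indicator (A \<times> B) z *\<^sub>R F z) \<in> borel_measurable lebesgue"
    using F by (subst borel_measurable_restrict_space_iff[symmetric]) auto
  then obtain F' where F': "F' \<in> borel_measurable lborel"
    "AE z in lborel. indicator (A \<times> B) z *\<^sub>R F z = F' z"
    using completion_ex_borel_measurable_real by blast
  show ?thesis
  proof
    show "F' \<in> borel_measurable borel" using F'(1) by simp
    show "AE z in lborel. indicator (A \<times> B) z * F z = F' z" using F'(2) by simp
    then show "AE t in lborel. AE x in lborel. indicator (A \<times> B) (x, t) * F (x, t) = F' (x, t)"
      by (rule AE_lborel_sections)
  qed
qed

lemma AE_section_measurable:
  fixes F :: "'a::euclidean_space \<times> 'b::euclidean_space \<Rightarrow> real"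
  assumes F: "F \<in> borel_measurable (lebesgue_on (A \<times> B))"
    and A: "A \<in> sets borel" and B: "B \<in> sets borel"
  shows "AE t in lebesgue_on B. (\<lambda>x. F (x, t)) \<in> borel_measurable (lebesgue_on A)"
proof -
  obtain F' where F': "F' \<in> borel_measurable borel"
    "AE t in lborel. AE x in lborel. indicator (A \<times> B) (x, t) * F (x, t) = F' (x, t)"
    using lebesgue_on_Times_Borel_representative[OF assms] by blast
  have "AE t in lborel. t \<in> B \<longrightarrow> (\<lambda>x. F (x, t)) \<in> borel_measurable (lebesgue_on A)"
    using F'(2)
  proof eventually_elim
    case (elim t)
    show ?case
    proof
      assume "t \<in> B"
      have "(\<lambda>x. F' (x, t)) \<in> borel_measurable borel"
        by (rule measurable_compose[OF borel_measurable_Pair F'(1)]) simp_all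
      then have "(\<lambda>x. F' (x, t)) \<in> borel_measurable lebesgue"
        by (intro measurable_completion) simp
      moreover have "AE x in lborel. indicator A x *\<^sub>R F (x, t) = F' (x, t)"
        using elim by eventually_elim (use \<open>t \<in> B\<close> in \<open>simp add: indicator_times\<close>)
      ultimately have "(\<lambda>x. indicator A x *\<^sub>R F (x, t)) \<in> borel_measurable lebesgue"
        by (rule borel_measurable_completion_AE_eq)
      then show "(\<lambda>x. F (x, t)) \<in> borel_measurable (lebesgue_on A)"
        using A by (subst borel_measurable_restrict_space_iff) auto
    qed
  qed
  moreover have "B \<in> sets lebesgue" using B by simp
  ultimately show ?thesis by (simp only: AE_lebesgue_on)
qed

lemma nn_integral_lebesgue_on_Times:
  fixes F :: "'a::euclidean_space \<times> 'b::euclidean_space \<Rightarrow> real"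
  assumes F: "F \<in> borel_measurable (lebesgue_on (A \<times> B))"
    and A: "A \<in> sets borel" and B: "B \<in> sets borel"
  shows "(\<lambda>t. \<integral>\<^sup>+x. ennreal (F (x, t)) \<partial>lebesgue_on A) \<in> borel_measurable (lebesgue_on B)"
    and "(\<integral>\<^sup>+z. ennreal (F z) \<partial>lebesgue_on (A \<times> B))
      = (\<integral>\<^sup>+t. (\<integral>\<^sup>+x. ennreal (F (x, t)) \<partial>lebesgue_on A) \<partial>lebesgue_on B)"
proof -
  let ?I = "\<lambda>t. \<integral>\<^sup>+x. ennreal (F (x, t)) \<partial>lebesgue_on A"
  obtain F' where F': "F' \<in> borel_measurable borel"
    "AE z in lborel. indicator (A \<times> B) z * F z = F' z"
    "AE t in lborel. AE x in lborel. indicator (A \<times> B) (x, t) * F (x, t) = F' (x, t)"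
    using lebesgue_on_Times_Borel_representative[OF assms] by blast
  have [measurable]: "F' \<in> borel_measurable (lborel \<Otimes>\<^sub>M lborel)"
    using F'(1) by (simp add: lborel_prod)
  have AB: "A \<times> B \<in> sets lebesgue"
    using A B by (intro sets_completionI_sets) (simp add: borel_Times)
  have inner: "AE t in lborel. ?I t * indicator B t = (\<integral>\<^sup>+x. ennreal (F' (x, t)) \<partial>lborel)"
    using F'(3)
  proof eventually_elim
    case (elim t)
    have "?I t * indicator B t = (\<integral>\<^sup>+x. ennreal (F (x, t)) * indicator A x \<partial>lborel) * indicator B t"
      using A by (subst nn_integral_restrict_space) (auto simp: nn_integral_completion)
    also have "\<dots> = (\<integral>\<^sup>+x. ennreal (indicator (A \<times> B) (x, t) * F (x, t)) \<partial>lborel)"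
      by (cases "t \<in> B") (auto intro!: nn_integral_cong split: split_indicator)
    also have "\<dots> = (\<integral>\<^sup>+x. ennreal (F' (x, t)) \<partial>lborel)"
      using elim by (intro nn_integral_cong_AE) auto
    finally show ?case .
  qed
  have "(\<lambda>t. \<integral>\<^sup>+x. ennreal (F' (x, t)) \<partial>lborel) \<in> borel_measurable lebesgue"
    by (intro measurable_completion) measurable
  from borel_measurable_completion_AE_eq[OF this inner]
  show "?I \<in> borel_measurable (lebesgue_on B)"
    using B by (subst borel_measurable_restrict_space_iff_ennreal) auto
  have "(\<integral>\<^sup>+z. ennreal (F z) \<partial>lebesgue_on (A \<times> B)) 
      = (\<integral>\<^sup>+z. ennreal (F z) * indicator (A \<times> B) z \<partial>lborel)"
    using AB by (subst nn_integral_restrict_space) (auto simp: nn_integral_completion)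
  also have "\<dots> = (\<integral>\<^sup>+z. ennreal (F' z) \<partial>lborel)"
  proof (rule nn_integral_cong_AE)
    show "AE z in lborel. ennreal (F z) * indicator (A \<times> B) z = ennreal (F' z)"
      using F'(2) by eventually_elim (metis ennreal_0 indicator_eq_0_iff indicator_eq_1_iff mult.left_neutral mult.right_neutral mult_zero_left mult_zero_right)
  qed
  also have "\<dots> = (\<integral>\<^sup>+t. (\<integral>\<^sup>+x. ennreal (F' (x, t)) \<partial>lborel) \<partial>lborel)"
    using F'(1) by (subst lborel_pair.nn_integral_snd) (auto simp: lborel_prod)
  also have "\<dots> = (\<integral>\<^sup>+t. ?I t * indicator B t \<partial>lborel)"
    using inner by (intro nn_integral_cong_AE) auto
  also have "\<dots> = (\<integral>\<^sup>+t. ?I t \<partial>lebesgue_on B)"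
    using B by (subst nn_integral_restrict_space) (auto simp: nn_integral_completion)
  finally show "(\<integral>\<^sup>+z. ennreal (F z) \<partial>lebesgue_on (A \<times> B)) = (\<integral>\<^sup>+t. ?I t \<partial>lebesgue_on B)" .
qed

text \<open>
  Composition with a Borel map does not preserve Lebesgue measurability in general.  For the
  projection it does, since the preimage \<open>N \<times> UNIV\<close> of a null set \<open>N\<close> is a null set.
\<close>

lemma borel_measurable_fst_lebesgue_on:
  fixes g :: "'a::euclidean_space \<Rightarrow> real" and B :: "'b::euclidean_space set"
  assumes g: "g \<in> borel_measurable (lebesgue_on A)"
    and A: "A \<in> sets borel" and B: "B \<in> sets borel"
  shows "(\<lambda>z. g (fst z)) \<in> borel_measurable (lebesgue_on (A \<times> B))"
proof -
  have AB: "A \<times> B \<in> sets lebesgue"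
    using A B by (intro sets_completionI_sets) (simp add: borel_Times)
  have "(\<lambda>x. indicator A x *\<^sub>R g x) \<in> borel_measurable lebesgue"
    using g A by (subst borel_measurable_restrict_space_iff[symmetric]) auto
  then obtain g' where [measurable]: "g' \<in> borel_measurable lborel" 
    and g': "AE x in lborel. indicator A x *\<^sub>R g x = g' x"
    using completion_ex_borel_measurable_real by blast
  obtain N where N: "N \<in> null_sets lborel" "{x. indicator A x *\<^sub>R g x \<noteq> g' x} \<subseteq> N"
    using g' unfolding eventually_ae_filter by auto
  have [measurable]: "N \<in> sets lborel" using N(1) by auto
  have "AE z in lborel \<Otimes>\<^sub>M (lborel :: 'b measure). fst z \<notin> N"
  proof (intro lborel_pair.AE_pair_measure)
    have "{z \<in> space (lborel \<Otimes>\<^sub>M (lborel :: 'b measure)). fst z \<notin> N} = fst -` (- N) \<inter> space (lborel \<Otimes>\<^sub>M lborel)"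
      by auto
    also have "\<dots> \<in> sets (lborel \<Otimes>\<^sub>M lborel)"
      using \<open>N \<in> sets lborel\<close> by (intro measurable_sets[OF measurable_fst]) auto
    finally show "{z \<in> space (lborel \<Otimes>\<^sub>M (lborel :: 'b measure)). fst z \<notin> N} \<in> sets (lborel \<Otimes>\<^sub>M lborel)" .
    show "AE x in lborel. AE y in lborel. fst (x, y :: 'b) \<notin> N"
      using AE_not_in[OF N(1)] by eventually_elim simp
  qed
  then have "AE z in (lborel :: ('a \<times> 'b) measure). fst z \<notin> N"
    by (simp only: lborel_prod)
  then have "AE z in (lborel :: ('a \<times> 'b) measure). 
      indicator (A \<times> B) z *\<^sub>R g (fst z) = indicator (A \<times> B) z *\<^sub>R g' (fst z)"
  proof eventually_elim
    case (elim z)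
    then have "indicator A (fst z) *\<^sub>R g (fst z) = g' (fst z)" using N(2) by auto
    then show ?case by (auto simp: indicator_def split: if_splits)
  qed
  moreover have "(\<lambda>z. indicator (A \<times> B) z *\<^sub>R g' (fst z)) \<in> borel_measurable lebesgue"
  proof (intro borel_measurable_scaleR borel_measurable_indicator AB measurable_completion)
    have "(\<lambda>z. g' (fst z)) \<in> borel_measurable (lborel \<Otimes>\<^sub>M (lborel :: 'b measure))"
      by measurable
    then show "(\<lambda>z. g' (fst z)) \<in> borel_measurable (lborel :: ('a \<times> 'b) measure)"
      by (simp only: lborel_prod)
  qed
  ultimately have "(\<lambda>z. indicator (A \<times> B) z *\<^sub>R g (fst z)) \<in> borel_measurable lebesgue"
    by (rule borel_measurable_completion_AE_eq[rotated])
  then show ?thesis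
    using AB by (subst borel_measurable_restrict_space_iff) auto
qed

section \<open>Locality of weak gradients\<close>

definition C1_function :: "('a::euclidean_space \<Rightarrow> real) \<Rightarrow> bool" where
  "C1_function f \<longleftrightarrow> (\<exists>D. (\<forall>x. GDERIV f x :> D x) \<and> continuous_on UNIV D)"

lemma C1_function_continuous: "C1_function f \<Longrightarrow> continuous_on UNIV f"
  unfolding C1_function_def gderiv_def
  by (meson continuous_at_imp_continuous_on has_derivative_continuous)

lemma C1_function_mult:
  assumes "C1_function f" "C1_function g"
  shows "C1_function (\<lambda>x. f x * g x)"
proof -
  obtain D E where D: "\<And>x. GDERIV f x :> D x" "continuous_on UNIV D"
    and E: "\<And>x. GDERIV g x :> E x" "continuous_on UNIV E"
    using assms unfolding C1_function_def by blast
  have "continuous_on UNIV (\<lambda>x. f x *\<^sub>R E x + g x *\<^sub>R D x)"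
    using D(2) E(2) assms by (intro continuous_intros C1_function_continuous)
  then show ?thesis
    unfolding C1_function_def using GDERIV_mult[OF D(1) E(1)] by (intro exI conjI allI)
qed

lemma C1_function_prod:
  "finite I \<Longrightarrow> (\<And>i. i \<in> I \<Longrightarrow> C1_function (f i)) \<Longrightarrow> C1_function (\<lambda>x. \<Prod>i\<in>I. f i x)"
proof (induction I rule: finite_induct)
  case empty
  then show ?case
    unfolding C1_function_def by (auto intro!: exI[of _ "\<lambda>_. 0"] GDERIV_const)
qed (simp add: C1_function_mult)

lemma C1_function_compose:
  assumes f: "C1_function f" and h: "\<And>x. (h has_real_derivative h' (f x)) (at (f x))"
    and h': "continuous_on (range f) h'"
  shows "C1_function (\<lambda>x. h (f x))"
proof -
  obtain D where D: "\<And>x. GDERIV f x :> D x" "continuous_on UNIV D"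
    using f unfolding C1_function_def by blast
  have "continuous_on UNIV (\<lambda>x. h' (f x))"
    using continuous_on_compose[OF C1_function_continuous[OF f] h'] by (simp add: o_def)
  then have "continuous_on UNIV (\<lambda>x. h' (f x) *\<^sub>R D x)"
    using D(2) by (intro continuous_intros)
  then show ?thesis
    unfolding C1_function_def using GDERIV_DERIV_compose[OF D(1) h] by (intro exI conjI allI)
qed

lemma has_derivative_square_pos_part:
  "((\<lambda>s::real. (max 0 s)\<^sup>2) has_real_derivative 2 * max 0 s) (at s)"
proof -
  consider "s > 0" | "s < 0" | "s = 0" by linarith
  then show ?thesis
  proof cases
    case 1
    have "((\<lambda>s::real. s\<^sup>2) has_real_derivative 2 * max 0 s) (at s)"
      using 1 by (auto intro!: derivative_eq_intros)
    then show ?thesis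
      by (rule DERIV_cong_ev[THEN iffD1, rotated -1, OF _ refl _ refl])
         (use 1 in \<open>auto intro: eventually_mono[OF eventually_nhds_in_open[of "{0<..}"]]\<close>)
  next
    case 2
    have "((\<lambda>s::real. 0) has_real_derivative 2 * max 0 s) (at s)"
      using 2 by (auto intro!: derivative_eq_intros)
    then show ?thesis
      by (rule DERIV_cong_ev[THEN iffD1, rotated -1, OF _ refl _ refl])
         (use 2 in \<open>auto intro: eventually_mono[OF eventually_nhds_in_open[of "{..<0}"]]\<close>)
  next
    case 3
    have "((\<lambda>h::real. (max 0 h)\<^sup>2 / h) \<longlongrightarrow> 0) (at 0)"
    proof (rule Lim_null_comparison)
      show "\<forall>\<^sub>F h::real in at 0. norm ((max 0 h)\<^sup>2 / h) \<le> \<bar>h\<bar>"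
        by (intro always_eventually) (auto simp: max_def power2_eq_square)
    qed (auto intro!: tendsto_eq_intros)
    then show ?thesis
      using 3 by (simp add: DERIV_def)
  qed
qed

text \<open>
  A product \<open>w\<close> of squared positive parts of the distances to the faces is \<open>C\<^sup>1\<close> and positive exactly
  on the open box.  The functions \<open>w / (1/(k+1) + w)\<close> are then \<open>C\<^sup>1\<close> as well and increase to the
  indicator of the box.  Squares are needed because the positive part itself is not \<open>C\<^sup>1\<close>.
\<close>

lemma cutoff_functions_of_box:
  fixes l u :: "'a::euclidean_space"
  obtains \<psi> D\<psi> where
    "\<And>k x. GDERIV (\<psi> k) x :> D\<psi> k x" "\<And>k::nat. continuous_on UNIV (D\<psi> k)"
    "\<And>k x. \<bar>\<psi> k x\<bar> \<le> 1" "\<And>k x. x \<notin> box l u \<Longrightarrow> \<psi> k x = 0" 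
    "\<And>k x. x \<notin> box l u \<Longrightarrow> D\<psi> k x = 0"
    "\<And>x. (\<lambda>k. \<psi> k x) \<longlonglongrightarrow> indicator (box l u) x"
proof -
  define w :: "'a \<Rightarrow> real" where
    "w = (\<lambda>x. \<Prod>i\<in>Basis. (max 0 ((x - l) \<bullet> i))\<^sup>2 * (max 0 ((u - x) \<bullet> i))\<^sup>2)"
  define \<psi> where "\<psi> = (\<lambda>(k::nat) x. w x / (1 / Suc k + w x))"
  have w0: "w x \<ge> 0" for x
    unfolding w_def by (intro prod_nonneg) auto
  have wbox: "w x > 0 \<longleftrightarrow> x \<in> box l u" for x
  proof -
    have "w x > 0 \<longleftrightarrow> w x \<noteq> 0" using w0[of x] by linarith
    also have "\<dots> \<longleftrightarrow> (\<forall>i\<in>Basis. l \<bullet> i < x \<bullet> i \<and> x \<bullet> i < u \<bullet> i)"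
      unfolding w_def by (auto simp: max_def inner_diff_left)
    finally show ?thesis by (simp add: mem_box)
  qed
  have lin: "C1_function (\<lambda>x. (x - l) \<bullet> i)" "C1_function (\<lambda>x. (u - x) \<bullet> i)" for l u i :: 'a
    unfolding C1_function_def gderiv_def
    by (rule exI[of _ "\<lambda>_. i"] exI[of _ "\<lambda>_. - i"];
        auto intro!: derivative_eq_intros continuous_intros)+
  have "C1_function w"
    unfolding w_def
    by (intro C1_function_prod C1_function_mult 
        C1_function_compose[where h = "\<lambda>s. (max 0 s)\<^sup>2" and h' = "\<lambda>s. 2 * max 0 s"]
        has_derivative_square_pos_part lin continuous_intros) auto
  have pos: "1 / Suc k + w x > 0" for k x 
    by (intro add_pos_nonneg w0) auto
  have "C1_function (\<psi> k)" for k
  proof -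
    show ?thesis
      unfolding \<psi>_def
    proof (rule C1_function_compose[OF \<open>C1_function w\<close>])
      have "((\<lambda>s. s / (e + s)) has_real_derivative e / (e + t)\<^sup>2) (at t)" 
        if "e + t > 0" for e t :: real
        using that by (auto intro!: derivative_eq_intros simp: power2_eq_square)
      then show "((\<lambda>s. s / (1 / Suc k + s)) has_real_derivative 
          (\<lambda>s. (1 / Suc k) / (1 / Suc k + s)\<^sup>2) (w x)) (at (w x))" for x
        using pos[of k x] by blast
      show "continuous_on (range w) (\<lambda>s. (1 / Suc k) / (1 / Suc k + s)\<^sup>2)"
        using pos[of k] by (auto intro!: continuous_intros simp: less_imp_neq[symmetric])
    qed
  qed
  then obtain D\<psi> where D: "\<And>k x. GDERIV (\<psi> k) x :> D\<psi> k x" "\<And>k. continuous_on UNIV (D\<psi> k)"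
    unfolding C1_function_def by metis
  have \<psi>0: "\<psi> k x \<ge> 0" for k x
    unfolding \<psi>_def by (intro divide_nonneg_nonneg add_nonneg_nonneg w0) auto
  have zero: "\<psi> k x = 0" if "x \<notin> box l u" for k x
    using that wbox[of x] w0[of x] by (auto simp: \<psi>_def)
  show ?thesis
  proof
    show "GDERIV (\<psi> k) x :> D\<psi> k x" "continuous_on UNIV (D\<psi> k)" for k x
      using D by auto
    have "w x \<le> 1 / Suc k + w x" for k x by simp
    then show "\<bar>\<psi> k x\<bar> \<le> 1" for k x
      using \<psi>0[of k x] pos[of k x] w0[of x] unfolding \<psi>_def by (auto simp del: of_nat_Suc)
    show "\<psi> k x = 0" if "x \<notin> box l u" for k x
      using that by (rule zero)
    show "D\<psi> k x = 0" if "x \<notin> box l u" for k x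
    proof -
      \<comment> \<open>outside the box the cutoff attains its minimum 0\<close>
      have "(\<lambda>h. h \<bullet> D\<psi> k x) = (\<lambda>_. 0)"
        using D(1)[of k x] \<psi>0 zero[OF that]
        by (intro differential_zero_maxmin[of x UNIV "\<psi> k"]) (auto simp: gderiv_def)
      then show ?thesis by (metis inner_eq_zero_iff)
    qed
    show "(\<lambda>k. \<psi> k x) \<longlonglongrightarrow> indicator (box l u) x" for x
    proof (cases "x \<in> box l u")
      case True
      then have "w x > 0" by (simp add: wbox)
      have "(\<lambda>k. w x / (1 / Suc k + w x)) \<longlonglongrightarrow> w x / (0 + w x)"
        using \<open>w x > 0\<close> by (intro tendsto_intros LIMSEQ_Suc[OF lim_1_over_n]) auto
      then show ?thesis using True \<open>w x > 0\<close> by (simp add: \<psi>_def)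
    qed (simp add: zero)
  qed
qed

text \<open>
  Testing with the cutoffs of a box \<open>Q\<close> inside \<open>V\<close> gives \<open>\<integral> \<psi>\<^sub>k G = - \<integral> v \<nabla>\<psi>\<^sub>k = 0\<close>, and in the limit
  \<open>\<integral>\<^sub>Q G = 0\<close>.  For almost every \<open>x\<close> the value \<open>G x\<close> is the limit of the averages of \<open>G\<close> over small cubes
  at \<open>x\<close> (Lebesgue's differentiation theorem), hence \<open>G = 0\<close> almost everywhere on \<open>V\<close>.  Local integrability of
  \<open>G\<close> on \<open>U\<close> only controls compact subsets, hence the countable cover by closed boxes.
\<close>

lemma weak_gradient_zero_where_function_zero:
  fixes U V :: "'a::euclidean_space set"
  assumes wg: "has_weak_gradient U v G" and "open U" "open V" "V \<subseteq> U"
    and v0: "\<And>x. x \<in> V \<Longrightarrow> v x = 0"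
  shows "negligible {x \<in> V. G x \<noteq> 0}"
proof -
  have G_int: "G absolutely_integrable_on C" if "compact C" "C \<subseteq> V" for C
    using wg that \<open>V \<subseteq> U\<close> unfolding has_weak_gradient_def by blast
  have zero: "integral (cbox l u) G = 0" if sub: "cbox l u \<subseteq> V" for l u
  proof -
    obtain \<psi> D\<psi> where \<psi>: "\<And>k x. GDERIV (\<psi> k) x :> D\<psi> k x" "\<And>k::nat. continuous_on UNIV (D\<psi> k)"
      "\<And>k x. \<bar>\<psi> k x\<bar> \<le> 1" "\<And>k x. x \<notin> box l u \<Longrightarrow> \<psi> k x = 0"
      "\<And>k x. x \<notin> box l u \<Longrightarrow> D\<psi> k x = 0"
      "\<And>x. (\<lambda>k. \<psi> k x) \<longlonglongrightarrow> indicator (box l u) x"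
      using cutoff_functions_of_box[of l u] by metis
    have box_sub: "box l u \<subseteq> cbox l u" by (rule box_subset_cbox)
    have Gc: "set_integrable lebesgue (cbox l u) G"
      using G_int[OF compact_cbox sub] .
    have Gb: "integrable lebesgue (\<lambda>x. indicator (box l u) x *\<^sub>R G x)"
      using set_integrable_subset[OF Gc _ box_sub] by (simp add: set_integrable_def)
    have U: "U \<in> sets lebesgue" using \<open>open U\<close> by auto
    have "(\<integral>x. \<psi> k x *\<^sub>R G x \<partial>lebesgue) = 0" for k
    proof -
      have "test_function U (\<psi> k) (D\<psi> k)"
        unfolding test_function_def
      proof (intro conjI allI exI[of _ "cbox l u"] impI)
        show "cbox l u \<subseteq> U" using sub \<open>V \<subseteq> U\<close> by simp
        show "\<psi> k x = 0" if "x \<notin> cbox l u" for x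
          using \<psi>(4)[of x k] that box_sub by (meson subset_eq)
      qed (use \<psi>(1,2) in auto)
      then have "(\<integral>x. \<psi> k x *\<^sub>R G x \<partial>lebesgue_on U) = - (\<integral>x. v x *\<^sub>R D\<psi> k x \<partial>lebesgue_on U)"
        using wg unfolding has_weak_gradient_def by simp
      also have "(\<lambda>x. v x *\<^sub>R D\<psi> k x) = (\<lambda>_. 0)"
        using \<psi>(5) v0 sub box_sub by (metis (no_types) scaleR_eq_0_iff subset_eq)
      finally have "(\<integral>x. \<psi> k x *\<^sub>R G x \<partial>lebesgue_on U) = 0" by simp
      moreover have "\<psi> k x = 0" if "x \<notin> U" for x
        using \<psi>(4)[of x k] that sub \<open>V \<subseteq> U\<close> box_sub by (meson subset_eq)
      then have "(\<integral>x. \<psi> k x *\<^sub>R G x \<partial>lebesgue_on U) = (\<integral>x. \<psi> k x *\<^sub>R G x \<partial>lebesgue)"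
        using U by (subst integral_restrict_space)
           (auto intro!: Bochner_Integration.integral_cong split: split_indicator)
      ultimately show ?thesis by simp
    qed
    moreover have "(\<lambda>k. \<integral>x. \<psi> k x *\<^sub>R G x \<partial>lebesgue) 
        \<longlonglongrightarrow> (\<integral>x. indicator (box l u) x *\<^sub>R G x \<partial>lebesgue)"
    proof (rule integral_dominated_convergence)
      show "(\<lambda>x. indicator (box l u) x *\<^sub>R G x) \<in> borel_measurable lebesgue"
        using Gb by auto
      have eq: "\<psi> k x *\<^sub>R G x = \<psi> k x *\<^sub>R (indicator (box l u) x *\<^sub>R G x)" for k x
        using \<psi>(4)[of x k] by (auto split: split_indicator)
      have "continuous_on UNIV (\<psi> k)" for k
        using \<psi>(1)[of k] \<psi>(2)[of k] by (intro C1_function_continuous) (auto simp: C1_function_def)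
      then have "\<psi> k \<in> borel_measurable lebesgue" for k
        by (intro measurable_completion) (simp add: borel_measurable_continuous_onI)
      then show "(\<lambda>x. \<psi> k x *\<^sub>R G x) \<in> borel_measurable lebesgue" for k
        unfolding eq by (rule borel_measurable_scaleR[OF _ borel_measurable_integrable[OF Gb]])
      show "integrable lebesgue (\<lambda>x. norm (indicator (box l u) x *\<^sub>R G x))"
        using Gb by (rule integrable_norm)
      show "AE x in lebesgue. (\<lambda>k. \<psi> k x *\<^sub>R G x) \<longlonglongrightarrow> indicator (box l u) x *\<^sub>R G x"
        using \<psi>(6) by (intro AE_I2 tendsto_intros)
      show "AE x in lebesgue. norm (\<psi> k x *\<^sub>R G x) \<le> norm (indicator (box l u) x *\<^sub>R G x)" for k
      proof (rule AE_I2)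
        fix x
        show "norm (\<psi> k x *\<^sub>R G x) \<le> norm (indicator (box l u) x *\<^sub>R G x)"
          unfolding eq norm_scaleR[of "\<psi> k x"] 
          using \<psi>(3)[of k x] by (intro mult_left_le_one_le) auto
      qed
    qed
    ultimately have "(\<integral>x. indicator (box l u) x *\<^sub>R G x \<partial>lebesgue) = 0"
      by (simp add: LIMSEQ_const_iff)
    then have "integral (box l u) G = 0"
      using set_lebesgue_integral_eq_integral(2)[of "box l u" G] Gb
      by (simp add: set_integrable_def set_lebesgue_integral_def)
    then show ?thesis by (simp add: integral_open_interval)
  qed
  obtain \<D> where \<D>: "countable \<D>" "\<D> \<subseteq> Pow V" "\<And>X. X \<in> \<D> \<Longrightarrow> \<exists>l u. X = cbox l u"
    "\<Union>\<D> = V"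
    by (rule open_countable_Union_open_cbox[OF \<open>open V\<close>]) (rule that)
  have "negligible {x \<in> C. G x \<noteq> 0}" if CD: "C \<in> \<D>" for C
  proof -
    obtain l u where C: "C = cbox l u" using \<D>(3)[OF CD] by blast
    have "C \<subseteq> V" using \<D>(2) CD by (meson Pow_iff subset_eq)
    define f where "f = (\<lambda>x. if x \<in> C then G x else 0)"
    have "G integrable_on C"
      using set_lebesgue_integral_eq_integral(1)[OF G_int[OF _ \<open>C \<subseteq> V\<close>]] C by simp
    then have "f integrable_on UNIV"
      unfolding f_def by (simp add: integrable_restrict_UNIV)
    then have "f integrable_on cbox p q" for p q
      by (rule integrable_on_subcbox) auto
    then obtain N where N: "negligible N" and 
      lim: "\<And>x e. \<lbrakk>x \<notin> N; 0 < e\<rbrakk> \<Longrightarrow> \<exists>d>0. \<forall>h. 0 < h \<and> h < d \<longrightarrow>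
        norm (integral (cbox x (x + h *\<^sub>R One)) f /\<^sub>R h ^ DIM('a) - f x) < e"
      using integrable_ccontinuous_explicit[of f] by metis
    have "G x = 0" if x: "x \<in> box l u" "x \<notin> N" for x
    proof (rule ccontr)
      assume "G x \<noteq> 0"
      then obtain d where d: "d > 0" and dd: "\<And>h. 0 < h \<Longrightarrow> h < d \<Longrightarrow>
        norm (integral (cbox x (x + h *\<^sub>R One)) f /\<^sub>R h ^ DIM('a) - f x) < norm (G x)"
        using lim[OF x(2), of "norm (G x)"] by auto
      \<comment> \<open>a side length for which the cube with lower corner x stays in the box\<close>
      define h where "h = Min (insert (d / 2) ((\<lambda>i. (u - x) \<bullet> i) ` Basis))"
      have h: "0 < h" "h < d"
        using x(1) d unfolding h_def mem_box by (auto simp: inner_diff_left Min_less_iff)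
      have h_le: "h \<le> (u - x) \<bullet> i" if "i \<in> Basis" for i
        unfolding h_def using that by (intro Min_le) auto
      have sub: "cbox x (x + h *\<^sub>R One) \<subseteq> C"
      proof
        fix y assume y: "y \<in> cbox x (x + h *\<^sub>R One)"
        have "l \<bullet> i \<le> y \<bullet> i \<and> y \<bullet> i \<le> u \<bullet> i" if i: "i \<in> Basis" for i
        proof -
          have "x \<bullet> i \<le> y \<bullet> i" "y \<bullet> i \<le> x \<bullet> i + h" "l \<bullet> i < x \<bullet> i"
            using y x(1) i by (auto simp: mem_box inner_add_left)
          then show ?thesis using h_le[OF i] by (simp add: inner_diff_left)
        qed
        then show "y \<in> C" by (simp add: C mem_box)
      qed
      have "integral (cbox x (x + h *\<^sub>R One)) f = integral (cbox x (x + h *\<^sub>R One)) G"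
        using sub by (intro integral_cong) (auto simp: f_def)
      also have "\<dots> = 0"
        by (rule zero[OF subset_trans[OF sub \<open>C \<subseteq> V\<close>]])
      finally show False
        using dd[OF h(1,2)] x(1) box_subset_cbox[of l u] C by (auto simp: f_def)
    qed
    then have "{x \<in> C. G x \<noteq> 0} \<subseteq> N \<union> (cbox l u - box l u)"
      using C by auto
    then show ?thesis
      using N negligible_frontier_interval negligible_Un negligible_subset by blast
  qed
  then have "negligible (\<Union>C\<in>\<D>. {x \<in> C. G x \<noteq> 0})"
    using \<D>(1) by (intro negligible_countable_Union) auto
  moreover have "{x \<in> V. G x \<noteq> 0} \<subseteq> (\<Union>C\<in>\<D>. {x \<in> C. G x \<noteq> 0})"
    using \<D>(4) by auto
  ultimately show ?thesis by (rule negligible_subset)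
qed

lemma weak_gradient_measurable:
  assumes wg: "has_weak_gradient U v G" and "open U"
  shows "G \<in> borel_measurable (lebesgue_on U)"
proof -
  obtain \<D> where \<D>: "countable \<D>" "\<D> \<subseteq> Pow U" "\<And>X. X \<in> \<D> \<Longrightarrow> \<exists>l u. X = cbox l u"
    "\<Union>\<D> = U"
    by (rule open_countable_Union_open_cbox[OF \<open>open U\<close>]) (rule that)
  have cbox: "compact C" "C \<in> sets lebesgue" "C \<subseteq> U" if C: "C \<in> \<D>" for C
  proof -
    obtain l u where "C = cbox l u" using \<D>(3)[OF C] by blast
    then show "compact C" "C \<in> sets lebesgue" by simp_all
    show "C \<subseteq> U" using \<D>(2) C by (meson Pow_iff subset_eq)
  qed
  show ?thesis
  proof (rule measurable_piecewise_restrict[OF \<D>(1)])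
    fix C assume C: "C \<in> \<D>"
    have eq: "C \<inter> space (lebesgue_on U) = C" using cbox[OF C] by auto
    show "C \<inter> space (lebesgue_on U) \<in> sets (lebesgue_on U)"
      unfolding eq using cbox[OF C] \<open>open U\<close> by (simp add: sets_restrict_space_iff)
    have "set_integrable lebesgue C G"
      using wg cbox[OF C] unfolding has_weak_gradient_def by simp
    then have "G \<in> borel_measurable (lebesgue_on C)"
      using cbox(2)[OF C] unfolding set_integrable_def
      by (subst borel_measurable_restrict_space_iff) auto
    moreover have "restrict_space (lebesgue_on U) C = lebesgue_on C"
      using cbox[OF C] \<open>open U\<close> 
      by (subst restrict_restrict_space) (auto simp: Int_absorb1)
    ultimately show "G \<in> borel_measurable (restrict_space (lebesgue_on U) C)" by simp
  qed (use \<D>(4) in simp)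
qed

section \<open>The conductivity and the weighted energy\<close>

lemma powr_le_1_plus_powr:
  fixes s p q :: real
  assumes "0 \<le> s" "0 < p" "p \<le> q"
  shows "s powr p \<le> 1 + s powr q"
proof (cases "s \<le> 1")
  case True
  then have "s powr p \<le> 1" using assms by (intro powr_le1) auto
  then show ?thesis by (simp add: add_increasing2)
next
  case False
  then have "s powr p \<le> s powr q" using assms by (intro powr_mono) auto
  then show ?thesis by simp
qed

text \<open>
  All estimates of the conductivity are pointwise in \<open>x\<close>, so the coefficients are studied at one
  fixed point.
\<close>

locale forchheimer =
  fixes N :: nat and \<alpha> :: "nat \<Rightarrow> real" and a :: "nat \<Rightarrow> 'a \<Rightarrow> real" and x :: 'a
  assumes N: "N \<ge> 1" and \<alpha>0: "\<alpha> 0 = 0" and \<alpha>_Suc: "\<And>j. j < N \<Longrightarrow> \<alpha> j < \<alpha> (Suc j)"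
    and a0: "a 0 x > 0" and aN: "a N x > 0" and a_mid: "\<And>j. 0 < j \<Longrightarrow> j < N \<Longrightarrow> a j x \<ge> 0"
begin

lemma \<alpha>_less: "i < j \<Longrightarrow> j \<le> N \<Longrightarrow> \<alpha> i < \<alpha> j"
proof (induction j)
  case (Suc j)
  then show ?case using \<alpha>_Suc[of j] by (cases "i = j") force+
qed simp

lemma \<alpha>_pos: "0 < j \<Longrightarrow> j \<le> N \<Longrightarrow> 0 < \<alpha> j"
  using \<alpha>_less[of 0 j] \<alpha>0 by simp

lemma a_nonneg: "j \<le> N \<Longrightarrow> 0 \<le> a j x"
  using a0 aN a_mid[of j] by (cases "j = 0 \<or> j = N") auto

lemma forch_exp_bounds: "0 < forch_exp N \<alpha>" "forch_exp N \<alpha> < 1"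
  using \<alpha>_pos[of N] N by (auto simp: forch_exp_def)

lemma rpow_mono: "0 \<le> s \<Longrightarrow> s \<le> t \<Longrightarrow> j \<le> N \<Longrightarrow> rpow s (\<alpha> j) \<le> rpow t (\<alpha> j)"
  using \<alpha>_pos[of j] \<alpha>0 by (cases "j = 0") (auto simp: rpow_def intro: powr_mono2)

lemma rpow_nonneg: "0 \<le> rpow s p"
  by (simp add: rpow_def)

lemma forch_g_mono: "0 \<le> s \<Longrightarrow> s \<le> t \<Longrightarrow> forch_g N \<alpha> a x s \<le> forch_g N \<alpha> a x t"
  unfolding forch_g_def by (intro sum_mono mult_left_mono rpow_mono a_nonneg) auto

lemma a0_le_forch_g: "a 0 x \<le> forch_g N \<alpha> a x s"
proof -
  have "a 0 x = a 0 x * rpow s (\<alpha> 0)" by (simp add: rpow_def \<alpha>0)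
  also have "\<dots> \<le> forch_g N \<alpha> a x s"
    unfolding forch_g_def by (intro member_le_sum mult_nonneg_nonneg rpow_nonneg a_nonneg) auto
  finally show ?thesis .
qed

lemma aN_le_forch_g: "a N x * s powr \<alpha> N \<le> forch_g N \<alpha> a x s"
proof -
  have "a N x * s powr \<alpha> N = a N x * rpow s (\<alpha> N)" using \<alpha>_pos[of N] N by (simp add: rpow_def)
  also have "\<dots> \<le> forch_g N \<alpha> a x s"
    unfolding forch_g_def by (intro member_le_sum mult_nonneg_nonneg rpow_nonneg a_nonneg) auto
  finally show ?thesis .
qed

text \<open>
  Since \<open>g(x,s) \<ge> a\<^sub>0(x) > 0\<close> and \<open>g(x,\<cdot>)\<close> is increasing, \<open>s \<mapsto> s g(x,s)\<close> is strictly increasing and reaches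
  \<open>\<xi>\<close> on \<open>[0, \<xi> / a\<^sub>0(x)]\<close>.
\<close>

lemma forch_s_solves:
  assumes "0 \<le> \<xi>"
  shows "0 \<le> forch_s N \<alpha> a x \<xi>"
    and "forch_s N \<alpha> a x \<xi> * forch_g N \<alpha> a x (forch_s N \<alpha> a x \<xi>) = \<xi>"
proof -
  let ?h = "\<lambda>s. s * forch_g N \<alpha> a x s"
  have less: "?h s < ?h t" if "0 \<le> s" "s < t" for s t
    using that a0 a0_le_forch_g[of t] a0_le_forch_g[of s] forch_g_mono[of s t]
    by (intro mult_less_le_imp_less) auto
  have "continuous_on {0..} (\<lambda>s. rpow s (\<alpha> j))" if "j \<le> N" for j
  proof (cases "j = 0")
    case False
    then have "0 < \<alpha> j" using \<alpha>_pos that by simp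
    then have "continuous_on {0..} (\<lambda>s::real. s powr \<alpha> j)"
      by (intro continuous_on_powr' continuous_intros) auto
    with \<open>0 < \<alpha> j\<close> show ?thesis by (simp add: rpow_def)
  qed (simp add: rpow_def \<alpha>0)
  then have cont: "continuous_on {0..} ?h"
    unfolding forch_g_def by (auto intro!: continuous_intros)
  have "\<xi> \<le> ?h (\<xi> / a 0 x)"
    using assms a0 a0_le_forch_g[of "\<xi> / a 0 x"] mult_left_mono[of "a 0 x" _ "\<xi> / a 0 x"] by simp
  then have "\<exists>s. 0 \<le> s \<and> s \<le> \<xi> / a 0 x \<and> ?h s = \<xi>"
    using assms a0 by (intro IVT' continuous_on_subset[OF cont]) auto
  then have "\<exists>!s. 0 \<le> s \<and> ?h s = \<xi>"
    using less by (metis less_irrefl linorder_neqE)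
  then show "0 \<le> forch_s N \<alpha> a x \<xi>" "?h (forch_s N \<alpha> a x \<xi>) = \<xi>"
    unfolding forch_s_def by (auto dest!: theI')
qed

lemma a_le_forch_M: "j \<le> N \<Longrightarrow> a j x \<le> forch_M N a x"
  unfolding forch_M_def by (intro Max_ge) auto

lemma forch_M_pos: "0 < forch_M N a x"
  using a_le_forch_M[of N] aN by simp

lemma forch_W1_pos: "0 < forch_W1 N \<alpha> a x"
  unfolding forch_W1_def using aN forch_M_pos N by (intro divide_pos_pos) auto

text \<open>
  Each of the \<open>N - 1\<close> intermediate powers is at most \<open>1 + s\<^bsup>\<alpha>N\<^esup>\<close>, and the first and the last one
  together add up to \<open>1 + s\<^bsup>\<alpha>N\<^esup>\<close>; this is where the factor \<open>N\<close> in the weight \<open>W\<^sub>1\<close> comes from.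
\<close>

lemma forch_g_le:
  assumes "0 \<le> s"
  shows "forch_g N \<alpha> a x s \<le> N * forch_M N a x * (1 + s powr \<alpha> N)"
proof -
  have "forch_g N \<alpha> a x s \<le> (\<Sum>j\<le>N. forch_M N a x * rpow s (\<alpha> j))"
    unfolding forch_g_def by (intro sum_mono mult_right_mono a_le_forch_M rpow_nonneg) auto
  also have "\<dots> = forch_M N a x * (\<Sum>j\<le>N. rpow s (\<alpha> j))"
    by (simp add: sum_distrib_left)
  also have "(\<Sum>j\<le>N. rpow s (\<alpha> j)) \<le> N * (1 + s powr \<alpha> N)"
  proof -
    have rpow_\<alpha>0: "rpow s (\<alpha> 0) = 1" and rpow_\<alpha>N: "rpow s (\<alpha> N) = s powr \<alpha> N"
      using N \<alpha>_pos[of N] by (auto simp: rpow_def \<alpha>0)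
    have "{..N} = insert 0 (insert N {0<..<N})" using N by auto
    then have "(\<Sum>j\<le>N. rpow s (\<alpha> j)) = 1 + (s powr \<alpha> N + (\<Sum>j\<in>{0<..<N}. rpow s (\<alpha> j)))"
      using N rpow_\<alpha>0 rpow_\<alpha>N by simp
    also have "(\<Sum>j\<in>{0<..<N}. rpow s (\<alpha> j)) \<le> (\<Sum>j\<in>{0<..<N}. 1 + s powr \<alpha> N)"
    proof (intro sum_mono)
      fix j assume "j \<in> {0<..<N}"
      then have "0 < \<alpha> j" "\<alpha> j \<le> \<alpha> N" using \<alpha>_pos[of j] \<alpha>_less[of j N] by auto
      then show "rpow s (\<alpha> j) \<le> 1 + s powr \<alpha> N"
        using powr_le_1_plus_powr[OF assms] by (simp add: rpow_def)
    qed
    also have "\<dots> = (real N - 1) * (1 + s powr \<alpha> N)"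
      using N by (simp add: of_nat_diff)
    finally show ?thesis by (simp add: algebra_simps)
  qed
  finally show ?thesis
    using forch_M_pos by (simp add: algebra_simps)
qed

text \<open>
  With \<open>s = s(x,\<xi>)\<close>, the last term of \<open>g\<close> alone gives \<open>a\<^sub>N s\<^bsup>\<alpha>N+1\<^esup> \<le> s g(x,s) = \<xi>\<close>, that is,
  \<open>s\<^bsup>\<alpha>N\<^esup> \<le> (\<xi> / a\<^sub>N)\<^bsup>b\<^esup>\<close> for the exponent \<open>b = \<alpha>\<^sub>N / (\<alpha>\<^sub>N + 1)\<close>.  Inserting this in the upper bound of \<open>g\<close> bounds
  \<open>1 / K\<close>.
\<close>

lemma forch_K_lower_bound:
  assumes "0 \<le> \<xi>"
  shows "2 * forch_W1 N \<alpha> a x / (\<xi> powr forch_exp N \<alpha> + a N x powr forch_exp N \<alpha>)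
    \<le> forch_K N \<alpha> a x \<xi>"
proof -
  define s where "s = forch_s N \<alpha> a x \<xi>"
  define g where "g = forch_g N \<alpha> a x s"
  define b where "b = forch_exp N \<alpha>"
  define A where "A = a N x"
  have s: "0 \<le> s" "s * g = \<xi>"
    using forch_s_solves[OF assms] by (auto simp: s_def g_def)
  have "0 < \<alpha> N" using \<alpha>_pos[of N] N by simp
  have A: "0 < A" using aN by (simp add: A_def)
  have "A * s powr (\<alpha> N + 1) \<le> \<xi>"
    using mult_left_mono[OF aN_le_forch_g[of s] s(1)] s by (simp add: powr_add g_def A_def mult_ac)
  then have "(s powr (\<alpha> N + 1)) powr b \<le> (\<xi> / A) powr b"
    using A assms forch_exp_bounds by (intro powr_mono2) (auto simp: field_simps b_def)
  then have "s powr \<alpha> N \<le> \<xi> powr b / A powr b"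
    using \<open>0 < \<alpha> N\<close> A assms by (simp add: powr_powr powr_divide b_def forch_exp_def)
  then have "1 + s powr \<alpha> N \<le> (\<xi> powr b + A powr b) / A powr b"
    using A by (simp add: add_divide_distrib)
  then have "g \<le> N * forch_M N a x * ((\<xi> powr b + A powr b) / A powr b)"
    using forch_g_le[OF s(1)] forch_M_pos unfolding g_def
    by (meson less_imp_le mult_left_mono mult_nonneg_nonneg of_nat_0_le_iff order_trans)
  moreover have "0 < g" using a0_le_forch_g[of s] a0 by (simp add: g_def)
  moreover have "0 < N * forch_M N a x * ((\<xi> powr b + A powr b) / A powr b)"
    using N forch_M_pos A by (intro mult_pos_pos divide_pos_pos add_nonneg_pos) auto
  ultimately have "1 / (N * forch_M N a x * ((\<xi> powr b + A powr b) / A powr b)) \<le> 1 / g"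
    by (intro frac_le) auto
  then show ?thesis
    using N by (simp add: forch_K_def forch_W1_def g_def s_def b_def A_def)
qed

text \<open>
  The factorisation to which the inequality of Hoelder is applied, with exponents \<open>p/2 + b/2 = 1\<close>.
  Writing \<open>m = (\<xi>\<^bsup>b\<^esup> + a\<^sub>N\<^bsup>b\<^esup>) / 2\<close>, so that \<open>L = W\<^sub>1 / m\<close>, it says \<open>W\<^sub>1 m\<^bsup>p/b\<^esup> \<le> a\<^sub>N + W\<^sub>1 \<xi>\<^bsup>p\<^esup>\<close>.  The mean \<open>m\<close> is at most the
  larger of \<open>\<xi>\<^bsup>b\<^esup>\<close> and \<open>a\<^sub>N\<^bsup>b\<^esup>\<close>, and the second alternative is absorbed by \<open>W\<^sub>1 a\<^sub>N\<^bsup>p\<^esup> = a\<^sub>N\<^sup>2 / (2 N M) \<le> a\<^sub>N\<close>.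
  The factor \<open>L\<close>, the lower bound of \<open>K\<close>, takes the place of \<open>K\<close> because it is visibly measurable
  in \<open>x\<close>.
\<close>

lemma W1_powr_le:
  fixes \<xi> \<gamma> b p L :: real
  assumes "0 \<le> \<xi>" "0 \<le> \<gamma>"
  defines "b \<equiv> forch_exp N \<alpha>"
  defines "p \<equiv> 2 - b"
  defines "L \<equiv> 2 * forch_W1 N \<alpha> a x / (\<xi> powr b + a N x powr b)"
  shows "forch_W1 N \<alpha> a x * \<gamma> powr p 
    \<le> (L * \<gamma>\<^sup>2) powr (p / 2) * (a N x + forch_W1 N \<alpha> a x * \<xi> powr p) powr (b / 2)"
proof -
  define W where "W = forch_W1 N \<alpha> a x"
  define A where "A = a N x"
  define m where "m = (\<xi> powr b + A powr b) / 2"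
  have b: "0 < b" "b < 1" "0 < p" using forch_exp_bounds by (auto simp: b_def p_def)
  have A: "0 < A" using aN by (simp add: A_def)
  have W: "0 < W" using forch_W1_pos by (simp add: W_def)
  have m: "0 < m" using A by (simp add: m_def add_nonneg_pos)
  have WA: "W * A powr p \<le> A"
  proof -
    have "W * A powr p = A\<^sup>2 / (2 * N * forch_M N a x)"
      using A by (simp add: W_def forch_W1_def p_def A_def b_def powr_add[symmetric])
    also have "\<dots> \<le> A\<^sup>2 / A"
    proof (intro divide_left_mono)
      have "A \<le> forch_M N a x" using a_le_forch_M[of N] by (simp add: A_def)
      also have "\<dots> = 1 * forch_M N a x" by simp
      also have "\<dots> \<le> 2 * N * forch_M N a x" 
        using N forch_M_pos by (intro mult_right_mono) auto
      finally show "A \<le> 2 * N * forch_M N a x" .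
    qed (use A N forch_M_pos in auto)
    finally show ?thesis using A by (simp add: power2_eq_square)
  qed
  have "m powr (p / b) \<le> max (\<xi> powr b) (A powr b) powr (p / b)"
    using m b by (intro powr_mono2) (auto simp: m_def)
  also have "\<dots> \<le> \<xi> powr p + A powr p"
    using b A by (auto simp: max_def powr_powr)
  finally have "W * m powr (p / b) \<le> W * \<xi> powr p + W * A powr p"
    using W by (metis distrib_left less_imp_le mult_left_mono)
  then have "W * m powr (p / b) \<le> A + W * \<xi> powr p"
    using WA by linarith
  then have "(W * m powr (p / b)) powr (b / 2) \<le> (A + W * \<xi> powr p) powr (b / 2)"
    using b W by (intro powr_mono2) auto
  then have main: "W powr (b / 2) * m powr (p / 2) \<le> (A + W * \<xi> powr p) powr (b / 2)"
    using b W m by (simp add: powr_mult powr_powr)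
  have "W * \<gamma> powr p = (W powr (p / 2) * W powr (b / 2)) * \<gamma> powr p"
    using W by (simp add: powr_add[symmetric] p_def diff_divide_distrib)
  also have "\<dots> = W powr (p / 2) * \<gamma> powr p / m powr (p / 2) * (W powr (b / 2) * m powr (p / 2))"
    using m by simp
  also have "\<dots> \<le> W powr (p / 2) * \<gamma> powr p / m powr (p / 2) * (A + W * \<xi> powr p) powr (b / 2)"
    by (intro mult_left_mono main) auto
  also have "W powr (p / 2) * \<gamma> powr p / m powr (p / 2) = (L * \<gamma>\<^sup>2) powr (p / 2)"
  proof -
    have "L = W / m" by (simp add: L_def m_def W_def A_def)
    moreover have "(\<gamma>\<^sup>2) powr (p / 2) = \<gamma> powr p"
      using \<open>0 \<le> \<gamma>\<close> b by (cases "\<gamma> = 0") (auto simp: powr_powr powr_numeral[symmetric] simp del: powr_numeral)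
    ultimately show ?thesis
      using W m by (simp add: powr_mult powr_divide)
  qed
  finally show ?thesis by (simp add: W_def A_def)
qed

end

lemma forch_W1_measurable:
  assumes "\<And>j. j \<le> N \<Longrightarrow> a j \<in> borel_measurable M"
  shows "forch_W1 N \<alpha> a \<in> borel_measurable M"
proof -
  have "(\<lambda>x. Max ((\<lambda>j. a j x) ` {..N})) \<in> borel_measurable M"
    using assms by (intro borel_measurable_Max) auto
  then show ?thesis
    unfolding forch_W1_def[abs_def] forch_M_def using assms[of N]
    by (intro borel_measurable_divide borel_measurable_times borel_measurable_const powr_real_measurable) simp_all
qed

text \<open>
  The set \<open>P\<close> stands for the support: on its complement \<open>G\<close> vanishes, which allows the integral
  of \<open>W\<^sub>1 \<xi>\<^bsup>2-b\<^esup>\<close> to be restricted to \<open>P\<close>.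
\<close>

lemma weighted_norm_le_energy:
  fixes G :: "'a::euclidean_space \<Rightarrow> 'b::euclidean_space" and \<xi> :: "'a \<Rightarrow> real"
  assumes forch: "\<And>x. x \<in> S \<Longrightarrow> forchheimer N \<alpha> a x"
    and a_meas: "\<And>j. j \<le> N \<Longrightarrow> a j \<in> borel_measurable (lebesgue_on S)"
    and [measurable]: "G \<in> borel_measurable (lebesgue_on S)" "\<xi> \<in> borel_measurable (lebesgue_on S)"
      "P \<in> sets (lebesgue_on S)"
    and \<xi>0: "\<And>x. x \<in> S \<Longrightarrow> 0 \<le> \<xi> x"
    and G0: "AE x in lebesgue_on S. x \<notin> P \<longrightarrow> G x = 0"
    and b: "b = forch_exp N \<alpha>" "0 < b" "b < 1"
  shows "wLp_norm (2 - b) S (forch_W1 N \<alpha> a) G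
    \<le> ennpowr (\<integral>\<^sup>+x. ennreal (forch_K N \<alpha> a x (\<xi> x) * (norm (G x))\<^sup>2) \<partial>lebesgue_on S) (1 / 2)
      * ennpowr ((\<integral>\<^sup>+x. ennreal (a N x) \<partial>lebesgue_on S) 
        + (\<integral>\<^sup>+x. ennreal (forch_W1 N \<alpha> a x * \<xi> x powr (2 - b) * indicator P x) \<partial>lebesgue_on S))
        (b / (2 * (2 - b)))"
    (is "_ \<le> ennpowr ?K _ * ennpowr (?A + ?E) _")
proof -
  define p where "p = 2 - b"
  define W where "W = forch_W1 N \<alpha> a"
  define L where "L = (\<lambda>x. 2 * W x / (\<xi> x powr b + a N x powr b))"
  define H where "H = (\<lambda>x. a N x + W x * \<xi> x powr p * indicator P x)"
  have p: "0 < p" "p / 2 + b / 2 = 1" using b by (auto simp: p_def field_simps)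
  have [measurable]: "W \<in> borel_measurable (lebesgue_on S)" "a N \<in> borel_measurable (lebesgue_on S)"
    unfolding W_def using a_meas by (auto intro: forch_W1_measurable)
  have W0: "0 \<le> W x" and A0: "0 \<le> a N x" and L0: "0 \<le> L x" and H0: "0 \<le> H x" if "x \<in> S" for x
  proof -
    interpret forchheimer N \<alpha> a x using that by (rule forch)
    show "0 \<le> W x" "0 \<le> a N x" using forch_W1_pos aN by (auto simp: W_def)
    then show "0 \<le> L x" "0 \<le> H x" by (auto simp: L_def H_def)
  qed
  have "AE x in lebesgue_on S. ennreal (W x * norm (G x) powr p) 
      \<le> ennreal ((L x * (norm (G x))\<^sup>2) powr (p / 2) * H x powr (b / 2))"
    using G0 AE_space
  proof eventually_elim
    case (elim x)
    then have x: "x \<in> S" by simp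
    show ?case
    proof (cases "x \<in> P")
      case True
      interpret forchheimer N \<alpha> a x using x by (rule forch)
      show ?thesis
        using W1_powr_le[OF \<xi>0[OF x] norm_ge_zero[of "G x"]] True 
        by (intro ennreal_leI) (simp add: W_def L_def H_def p_def b)
    next
      case False
      then show ?thesis using elim by simp
    qed
  qed
  then have "(\<integral>\<^sup>+x. ennreal (W x * norm (G x) powr p) \<partial>lebesgue_on S)
      \<le> (\<integral>\<^sup>+x. ennreal ((L x * (norm (G x))\<^sup>2) powr (p / 2) * H x powr (b / 2)) \<partial>lebesgue_on S)"
    by (rule nn_integral_mono_AE)
  also have "\<dots> \<le> ennpowr (\<integral>\<^sup>+x. ennreal (L x * (norm (G x))\<^sup>2) \<partial>lebesgue_on S) (p / 2)
      * ennpowr (\<integral>\<^sup>+x. ennreal (H x) \<partial>lebesgue_on S) (b / 2)"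
  proof (rule nn_integral_Holder)
    show "(\<lambda>x. L x * (norm (G x))\<^sup>2) \<in> borel_measurable (lebesgue_on S)" 
      "H \<in> borel_measurable (lebesgue_on S)" 
      unfolding L_def H_def by measurable
  qed (use L0 H0 p b(2) in simp_all)
  also have "\<dots> \<le> ennpowr ?K (p / 2) * ennpowr (?A + ?E) (b / 2)"
  proof (intro mult_mono ennpowr_mono)
    show "(\<integral>\<^sup>+x. ennreal (L x * (norm (G x))\<^sup>2) \<partial>lebesgue_on S) \<le> ?K"
    proof (intro nn_integral_mono ennreal_leI mult_right_mono)
      fix x assume "x \<in> space (lebesgue_on S)"
      then have x: "x \<in> S" by simp
      interpret forchheimer N \<alpha> a x using x by (rule forch)
      show "L x \<le> forch_K N \<alpha> a x (\<xi> x)"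
        using forch_K_lower_bound[OF \<xi>0[OF x]] by (simp add: L_def W_def b)
    qed simp
    have "(\<integral>\<^sup>+x. ennreal (H x) \<partial>lebesgue_on S)
        = (\<integral>\<^sup>+x. ennreal (a N x) + ennreal (W x * \<xi> x powr p * indicator P x) \<partial>lebesgue_on S)"
      using A0 W0 by (intro nn_integral_cong) (simp add: H_def)
    also have "\<dots> = ?A + ?E"
      unfolding p_def W_def[symmetric] by (intro nn_integral_add) measurable
    finally show "(\<integral>\<^sup>+x. ennreal (H x) \<partial>lebesgue_on S) \<le> ?A + ?E" by simp
  qed (use p b in auto)
  finally have "ennpowr (\<integral>\<^sup>+x. ennreal (W x * norm (G x) powr p) \<partial>lebesgue_on S) (1 / p)
      \<le> ennpowr (ennpowr ?K (p / 2) * ennpowr (?A + ?E) (b / 2)) (1 / p)"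
    using p by (intro ennpowr_mono) auto
  also have "\<dots> = ennpowr ?K (1 / 2) * ennpowr (?A + ?E) (b / (2 * p))"
    using p by (simp add: ennpowr_mult ennpowr_ennpowr)
  also have "ennpowr (\<integral>\<^sup>+x. ennreal (W x * norm (G x) powr p) \<partial>lebesgue_on S) (1 / p) = wLp_norm p S W G"
    by (rule wLp_norm_eq[symmetric]) (fact | erule W0)+
  finally show ?thesis unfolding W_def p_def .
qed

section \<open>The space-time inequality\<close>

theorem corollary2p4:
  fixes U :: "(real ^ 'n) set"
    and N :: nat
    and \<alpha> :: "nat \<Rightarrow> real"
    and a :: "nat \<Rightarrow> real ^ 'n \<Rightarrow> real"
    and \<phi> :: "real ^ 'n \<Rightarrow> real"
    and X :: "(real ^ 'n \<Rightarrow> real) set"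
    and r r' c0 T b :: real
    and u f :: "real ^ 'n \<Rightarrow> real \<Rightarrow> real"
  assumes "CARD('n) \<ge> 2"
    and "bounded_C1_domain U"
    and "N \<ge> 1"
    and "\<alpha> 0 = 0"
    and "\<And>j. j < N \<Longrightarrow> \<alpha> j < \<alpha> (Suc j)"
    and "\<And>j. j \<le> N \<Longrightarrow> a j \<in> borel_measurable (lebesgue_on U)"
    and "\<And>x. x \<in> closure U \<Longrightarrow> a 0 x > 0"
    and "\<And>x. x \<in> closure U \<Longrightarrow> a N x > 0"
    and "\<And>j x. 0 < j \<Longrightarrow> j < N \<Longrightarrow> x \<in> closure U \<Longrightarrow> a j x \<ge> 0"
    and "b = forch_exp N \<alpha>"
    and "\<phi> \<in> borel_measurable (lebesgue_on U)"
    and "\<And>x. x \<in> U \<Longrightarrow> \<phi> x > 0"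
    and "r > 2"
    and "c0 > 0"
    and "is_wX0 U \<phi> (forch_W1 N \<alpha> a) r (2 - b) X"
    and "\<And>v. v \<in> X \<Longrightarrow>
      wLp_norm r U \<phi> v \<le> ennreal c0 * wLp_norm (2 - b) U (forch_W1 N \<alpha> a) (weak_grad U v)"
    and "r' = r / (r - 1)"
    and "T > 0"
    and "(\<lambda>(x, t). u x t) \<in> borel_measurable (lebesgue_on (Q_T U T))"
    and "u \<in> X_QT X T"
    and "(\<lambda>(x, t). f x t) \<in> borel_measurable (lebesgue_on (Q_T U T))"
    and "\<And>x t. x \<in> U \<Longrightarrow> 0 < t \<Longrightarrow> t < T \<Longrightarrow> f x t \<ge> 0"
  shows "wLp_norm (4 / r') (Q_T U T) (\<lambda>(x, t). \<phi> x) (\<lambda>(x, t). u x t)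
    \<le> ennreal (c0 powr (r' / 2))
      * ennpowr
          ((\<integral>\<^sup>+x. ennreal (a N x) \<partial>lebesgue_on U)
           + esssup (lebesgue_on {0<..<T})
               (\<lambda>t. \<integral>\<^sup>+x. ennreal (forch_W1 N \<alpha> a x * f x t powr (2 - b)
                              * indicator (supp_QT U T u) (x, t)) \<partial>lebesgue_on U))
          (b * r' / (4 * (2 - b)))
      * (esssup (lebesgue_on {0<..<T}) (\<lambda>t. wLp_norm 2 U \<phi> (\<lambda>x. u x t))
         + ennpowr
             (\<integral>\<^sup>+t. (\<integral>\<^sup>+x. ennreal (forch_K N \<alpha> a x (f x t)
                              * (norm (weak_grad U (\<lambda>x. u x t) x))\<^sup>2) \<partial>lebesgue_on U)
                \<partial>lebesgue_on {0<..<T})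
             (1 / 2))"
proof -
  let ?Q = "lebesgue_on {0<..<T}" and ?W = "forch_W1 N \<alpha> a" and ?p = "2 - b"
  let ?G = "\<lambda>t. weak_grad U (\<lambda>x. u x t)"
  let ?E = "\<lambda>t. \<integral>\<^sup>+x. ennreal (?W x * f x t powr ?p * indicator (supp_QT U T u) (x, t)) \<partial>lebesgue_on U"
  define I where "I = (\<integral>\<^sup>+x. ennreal (a N x) \<partial>lebesgue_on U) + esssup ?Q ?E"
  define S where "S = esssup ?Q (\<lambda>t. wLp_norm 2 U \<phi> (\<lambda>x. u x t))"
  define B where "B = (\<lambda>t. \<integral>\<^sup>+x. ennreal (forch_K N \<alpha> a x (f x t) * (norm (?G t x))\<^sup>2) \<partial>lebesgue_on U)"
  define J where "J = ennpowr (\<integral>\<^sup>+t. B t \<partial>?Q) (1 / 2)"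
  define q where "q = 4 - 4 / r"
  define A where "A = (\<lambda>t. \<integral>\<^sup>+x. ennreal (\<phi> x * norm (u x t) powr q) \<partial>lebesgue_on U)"
  define C where "C = ennpowr S (2 - 4 / r) * ennpowr (ennreal c0) 2 * ennpowr I (b / ?p)"

  have "open U" "U \<noteq> {}" using assms(2) by (auto simp: bounded_C1_domain_def)
  have UB: "U \<in> sets borel" and UL: "U \<in> sets lebesgue" using \<open>open U\<close> by auto
  have in_closure: "x \<in> closure U" if "x \<in> U" for x using that closure_subset by blast
  have forch: "forchheimer N \<alpha> a x" if "x \<in> U" for x
    using assms(3,4,5,7,8,9) in_closure[OF that] by unfold_locales auto
  have b: "0 < b" "b < 1"
  proof -
    obtain x where "x \<in> U" using \<open>U \<noteq> {}\<close> by blast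
    then interpret forchheimer N \<alpha> a x by (rule forch)
    show "0 < b" "b < 1" using forch_exp_bounds assms(10) by auto
  qed
  have r: "2 < r" and c0: "0 < c0" by fact+
  have q: "4 / r' = q" "1 / q = r' / 4" "0 < q"
  proof -
    show "4 / r' = q" unfolding assms(17) q_def using r by (simp add: field_simps)
    then show "1 / q = r' / 4" by auto
    show "0 < q" unfolding q_def using r by (simp add: field_simps)
  qed
  have \<phi>0: "0 \<le> \<phi> x" if "x \<in> U" for x using assms(12)[OF that] by simp

  \<comment> \<open>the elliptic estimate on a single time slice; only its last factor depends on t\<close>
  have slice: "A t \<le> C * B t" 
    if t: "t \<in> {0<..<T}" and vX: "(\<lambda>x. u x t) \<in> X"
      and f_meas: "(\<lambda>x. f x t) \<in> borel_measurable (lebesgue_on U)"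
      and S_le: "wLp_norm 2 U \<phi> (\<lambda>x. u x t) \<le> S"
      and E_le: "?E t \<le> esssup ?Q ?E" for t
  proof -
    define v where "v = (\<lambda>x. u x t)"
    define P where "P = {x \<in> U. (x, t) \<in> supp_QT U T u}"
    have v: "v \<in> borel_measurable (lebesgue_on U)" "\<exists>G. has_weak_gradient U v G"
      using vX assms(15) by (auto simp: is_wX0_def wX_def v_def)
    have wg: "has_weak_gradient U v (?G t)"
      unfolding weak_grad_def v_def[symmetric] using v(2) by (rule someI_ex)
    \<comment> \<open>off the slice P of the support u vanishes on an open set, hence so does its weak gradient\<close>
    define D where "D = closure {(x, t). (x, t) \<in> Q_T U T \<and> u x t \<noteq> 0}"
    have P_eq: "P = U \<inter> {x. (x, t) \<in> D}"
      using t by (auto simp: P_def supp_QT_def D_def)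
    have "closed {x. (x, t) \<in> D}"
      using closed_vimage[of D "\<lambda>x. (x, t)"] unfolding D_def vimage_def 
      by (simp add: continuous_on_Pair continuous_on_id)
    then have "P \<in> sets (lebesgue_on U)"
      unfolding P_eq using UL by (auto simp: sets_restrict_space)
    moreover have "open (U - P)"
    proof -
      have "U - P = U \<inter> - {x. (x, t) \<in> D}" unfolding P_eq by auto
      then show ?thesis using \<open>open U\<close> \<open>closed {x. (x, t) \<in> D}\<close> by auto
    qed
    moreover have "v x = 0" if "x \<in> U - P" for x
    proof (rule ccontr)
      assume "v x \<noteq> 0"
      then have "(x, t) \<in> D" 
        using that t unfolding D_def v_def by (intro closure_subset[THEN subsetD]) auto
      then show False using that unfolding P_eq by auto
    qed
    ultimately have P: "P \<in> sets (lebesgue_on U)" and "negligible {x \<in> U - P. ?G t x \<noteq> 0}"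
      using weak_gradient_zero_where_function_zero[OF wg \<open>open U\<close>, of "U - P"] by auto
    then have "AE x in lebesgue. \<not> (x \<in> U - P \<and> ?G t x \<noteq> 0)"
      using AE_not_in[of "{x \<in> U - P. ?G t x \<noteq> 0}" lebesgue]
      by (simp add: negligible_iff_null_sets)
    then have "AE x in lebesgue. x \<in> U \<longrightarrow> x \<notin> P \<longrightarrow> ?G t x = 0"
      by eventually_elim auto
    then have "AE x in lebesgue_on U. x \<notin> P \<longrightarrow> ?G t x = 0"
      using UL by (subst AE_restrict_space_iff) simp_all
    from weighted_norm_le_energy[OF forch assms(6) weak_gradient_measurable[OF wg \<open>open U\<close>] f_meas P _ this assms(10) b]
    have "wLp_norm ?p U ?W (?G t) \<le> ennpowr (B t) (1 / 2) 
        * ennpowr ((\<integral>\<^sup>+x. ennreal (a N x) \<partial>lebesgue_on U) 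
          + (\<integral>\<^sup>+x. ennreal (?W x * f x t powr ?p * indicator P x) \<partial>lebesgue_on U)) (b / (2 * ?p))"
      using assms(22) t by (simp add: B_def)
    also have "(\<integral>\<^sup>+x. ennreal (?W x * f x t powr ?p * indicator P x) \<partial>lebesgue_on U) = ?E t"
      by (intro nn_integral_cong) (simp add: P_def indicator_def)
    also have "ennpowr (B t) (1 / 2) * ennpowr ((\<integral>\<^sup>+x. ennreal (a N x) \<partial>lebesgue_on U) + ?E t) (b / (2 * ?p))
        \<le> ennpowr (B t) (1 / 2) * ennpowr I (b / (2 * ?p))"
      unfolding I_def using E_le b by (intro mult_left_mono ennpowr_mono add_left_mono) auto
    finally have "ennreal c0 * wLp_norm ?p U ?W (?G t) 
        \<le> ennreal c0 * (ennpowr (B t) (1 / 2) * ennpowr I (b / (2 * ?p)))"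
      by (rule mult_left_mono) simp
    then have le: "wLp_norm r U \<phi> v \<le> ennreal c0 * (ennpowr (B t) (1 / 2) * ennpowr I (b / (2 * ?p)))"
      using assms(16)[OF vX] unfolding v_def by (rule order_trans[rotated])
    have "A t \<le> ennpowr (wLp_norm 2 U \<phi> v) (2 - 4 / r) * ennpowr (wLp_norm r U \<phi> v) 2"
      using wLp_interpolation[OF assms(11) v(1) \<phi>0 r] by (simp add: A_def q_def v_def)
    also have "\<dots> \<le> ennpowr S (2 - 4 / r) 
        * ennpowr (ennreal c0 * (ennpowr (B t) (1 / 2) * ennpowr I (b / (2 * ?p)))) 2"
      using S_le le r by (intro mult_mono ennpowr_mono) (auto simp: v_def field_simps)
    also have "\<dots> = C * B t"
    proof -
      have "b / (2 * ?p) * 2 = b / ?p" using b by (simp add: field_simps)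
      then show ?thesis by (simp add: C_def ennpowr_mult ennpowr_ennpowr mult_ac)
    qed
    finally show ?thesis .
  qed

  have "AE t in ?Q. (\<lambda>x. (\<lambda>(x, t). f x t) (x, t)) \<in> borel_measurable (lebesgue_on U)"
    by (rule AE_section_measurable[OF assms(21) UB]) simp
  moreover have "AE t in ?Q. (\<lambda>x. u x t) \<in> X"
    using assms(20) by (simp add: X_QT_def)
  moreover have "AE t in ?Q. wLp_norm 2 U \<phi> (\<lambda>x. u x t) \<le> S"
    unfolding S_def by (rule esssup_AE)
  moreover have "AE t in ?Q. ?E t \<le> esssup ?Q ?E"
    by (rule esssup_AE)
  ultimately have AE_le: "AE t in ?Q. A t \<le> C * B t"
    using AE_space
  proof eventually_elim
    case (elim t)
    then show ?case by (intro slice) simp_all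
  qed

  have meas: "(\<lambda>z. \<phi> (fst z)) \<in> borel_measurable (lebesgue_on (Q_T U T))"
    by (rule borel_measurable_fst_lebesgue_on[OF assms(11) UB]) simp
  define F where "F = (\<lambda>z. \<phi> (fst z) * norm (case_prod u z) powr q)"
  have F: "F \<in> borel_measurable (lebesgue_on (Q_T U T))"
    unfolding F_def
    by (intro borel_measurable_times powr_real_measurable borel_measurable_const meas
        measurable_compose[OF assms(19) borel_measurable_norm])
  have A_meas: "A \<in> borel_measurable ?Q" and Tonelli: "(\<integral>\<^sup>+z. ennreal (F z) \<partial>lebesgue_on (Q_T U T)) = (\<integral>\<^sup>+t. A t \<partial>?Q)"
    using nn_integral_lebesgue_on_Times[OF F UB] by (simp_all add: A_def F_def)
  have "wLp_norm q (Q_T U T) (\<lambda>z. \<phi> (fst z)) (case_prod u)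
      = ennpowr (\<integral>\<^sup>+z. ennreal (F z) \<partial>lebesgue_on (Q_T U T)) (1 / q)"
    unfolding F_def
  proof (rule wLp_norm_eq)
    show "0 \<le> \<phi> (fst z)" if "z \<in> Q_T U T" for z using \<phi>0[of "fst z"] that by auto
  qed (fact meas assms(19))+
  then have lhs: "wLp_norm (4 / r') (Q_T U T) (\<lambda>(x, t). \<phi> x) (\<lambda>(x, t). u x t)
      = ennpowr (\<integral>\<^sup>+t. A t \<partial>?Q) (1 / q)"
    unfolding q(1) Tonelli by (simp add: case_prod_unfold)

  have "ennpowr (\<integral>\<^sup>+t. A t \<partial>?Q) (1 / q) 
      \<le> ennreal (c0 powr (r' / 2)) * ennpowr I (b * r' / (4 * ?p)) * (S + J)"
  proof (cases "C = top")
    case True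
    \<comment> \<open>the bound is trivial: 0 * top = 0 excludes a vanishing factor, so the right side is infinite\<close>
    then have "S \<noteq> 0" "I \<noteq> 0" "S = top \<or> I = top"
      by (auto simp: C_def ennreal_mult_eq_top_iff)
    moreover have "ennreal (c0 powr (r' / 2)) \<noteq> 0" using c0 by (simp add: ennreal_eq_0_iff)
    ultimately have "ennreal (c0 powr (r' / 2)) * ennpowr I (b * r' / (4 * ?p)) * (S + J) = top"
      by (auto simp: ennreal_mult_eq_top_iff)
    then show ?thesis by simp
  next
    case False
    have "(\<integral>\<^sup>+t. A t \<partial>?Q) \<le> C * (\<integral>\<^sup>+t. B t \<partial>?Q)"
      using A_meas AE_le False by (rule nn_integral_le_cmult)
    also have "(\<integral>\<^sup>+t. B t \<partial>?Q) = ennpowr J 2"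
      by (simp add: J_def ennpowr_ennpowr)
    finally have "ennpowr (\<integral>\<^sup>+t. A t \<partial>?Q) (1 / q) \<le> ennpowr (C * ennpowr J 2) (1 / q)"
      using q by (intro ennpowr_mono) auto
    also have "\<dots> = ennpowr (ennreal c0) (2 * (1 / q)) * ennpowr I (b / ?p * (1 / q)) 
        * (ennpowr S ((2 - 4 / r) * (1 / q)) * ennpowr J (2 * (1 / q)))"
      by (simp only: C_def ennpowr_mult ennpowr_ennpowr mult_ac)
    \<comment> \<open>the exponents of S and J add up to 1, so their product is at most S + J\<close>
    also have "\<dots> \<le> ennpowr (ennreal c0) (2 * (1 / q)) * ennpowr I (b / ?p * (1 / q)) * (S + J)"
    proof (intro mult_left_mono ennpowr_mult_le_add)
      have "(2 - 4 / r) * (1 / q) + 2 * (1 / q) = q * (1 / q)"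
        unfolding distrib_right[symmetric] by (simp add: q_def)
      then show "(2 - 4 / r) * (1 / q) + 2 * (1 / q) = 1" using q(3) by simp
      have "0 \<le> 2 - 4 / r" using r by (simp add: field_simps)
      then show "0 \<le> (2 - 4 / r) * (1 / q)" using q(3) by simp
    qed (use q in auto)
    also have "ennpowr (ennreal c0) (2 * (1 / q)) = ennreal (c0 powr (r' / 2))"
      unfolding q(2) using c0 by (simp add: ennpowr_ennreal)
    also have "b / ?p * (1 / q) = b * r' / (4 * ?p)"
      unfolding q(2) by simp
    finally show ?thesis .
  qed
  then show ?thesis
    unfolding lhs unfolding I_def S_def J_def B_def .
qed

end
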